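(* Let $\gamma\ge1$ and let $\mathcal{B}$ be a countably infinite subset of $\{z\in\mathbb{C}:\operatorname{Re}(z)\ge\gamma\}$; set $\theta_b(z)=1/(z+b)$. Assume $s>0$ satisfies $\sum_{b\in\mathcal{B}}|b|^{-2s}<\infty$. Let $H\subset\mathbb{C}=\mathbb{R}^2$ be a bounded, mildly regular open set with $H\supset G_\gamma=\{z:|z-1/(2\gamma)|<1/(2\gamma)\}$ and $\operatorname{Re}(z)>0$ for all $z\in H$. Then the formula $$(L_sf)(z)=\sum_{b\in\mathcal{B}}\frac{f(\theta_b(z))}{|z+b|^{2s}}$$ defines a bounded linear map $L_s:C_{\mathbb{C}}(\bar H)\to C_{\mathbb{C}}(\bar H)$, and $L_s$ has a strictly positive Lipschitz eigenfunction $v_s$, unique up to scalar multiples, which satisfies on $\bar H$: (i) $v_s(z_0)\le v_s(z_1)\exp[(\sqrt5s/\gamma)|z_1-z_0|]$ for $z_0,z_1\in\bar H$; (ii) $v_s(x_1,y)\ge v_s(x_2,y)\ge v_s(x_1,y)\exp[(-2s/\gamma)(x_2-x_1)]$ whenever $0\le x_1\le x_2$ and $(x_1,y),(x_2,y)\in\bar H$; (iii) $v_s(x,y_1)\le v_s(x,y_2)\exp[(s/\gamma)|y_1-y_2|]$ whenever $(x,y_1),(x,y_2)\in\bar H$. If $\mathcal{B}$ and $H$ are symmetric under conjugation, then $v_s(\bar z)=v_s(z)$ for all $z\in\bar H$.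
   Context: A bounded open set $H\subset\mathbb{R}^n$ is mildly regular if there exist $\eta>0$ and $M\ge1$ such that whenever $x,y\in H$ and $\|x-y\|<\eta$, there is a Lipschitz map $\psi:[0,1]\to H$ with $\psi(0)=x$, $\psi(1)=y$ and $\int_0^1\|\psi'(t)\|\,dt\le M\|x-y\|$. $C_{\mathbb{C}}(\bar H)$ is the Banach space of continuous complex functions on $\bar H$ with the sup norm. We write $v_s(x,y)=v_s(x+\mathrm{i}y)$. A set $S\subset\mathbb{C}$ is symmetric under conjugation if $S=\{\bar z:z\in S\}$. "Strictly positive" means positive at every point of $\bar H$. *)

theory Defs
  imports "HOL-Analysis.Analysis"
begin

definition mildly_regular :: "'a::euclidean_space set \<Rightarrow> bool" where
  "mildly_regular H \<longleftrightarrow> bounded H \<and> open H \<and>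
     (\<exists>\<eta>>0. \<exists>M\<ge>1. \<forall>x\<in>H. \<forall>y\<in>H. norm (x - y) < \<eta> \<longrightarrow>
        (\<exists>\<psi> :: real \<Rightarrow> 'a. (\<exists>C. C-lipschitz_on {0..1} \<psi>) \<and> \<psi> ` {0..1} \<subseteq> H \<and>
           \<psi> 0 = x \<and> \<psi> 1 = y \<and>
           (\<lambda>t. norm (vector_derivative \<psi> (at t))) integrable_on {0..1} \<and>
           integral {0..1} (\<lambda>t. norm (vector_derivative \<psi> (at t))) \<le> M * norm (x - y)))"

definition G_disk :: "real \<Rightarrow> complex set" where
  "G_disk \<gamma> = ball (complex_of_real (1 / (2 * \<gamma>))) (1 / (2 * \<gamma>))"

definition Lop :: "real \<Rightarrow> complex set \<Rightarrow> (complex \<Rightarrow> complex) \<Rightarrow> complex \<Rightarrow> complex" where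
  "Lop s B f z = (\<Sum>\<^sub>\<infinity>b\<in>B. f (1 / (z + b)) / complex_of_real (norm (z + b) powr (2 * s)))"

end

theory Submission
  imports Defs "HOL-Complex_Analysis.Great_Picard"
begin

text \<open>
  On the right half-plane the kernels \<open>\<bar>z + \<xi>\<bar> powr (- 2 * s)\<close> with \<open>Re \<xi> \<ge> \<gamma>\<close> satisfy the
  inequalities (i)--(iii), and \<open>L\<^sub>s\<close> maps such a kernel to a positive series of kernels with
  parameters \<open>b + 1/\<xi>\<close>. Hence \<open>L\<^sub>s\<close> preserves the uniformly closed cone generated by the kernels.
  By Arzela--Ascoli, normalised iterates of one kernel have a uniform limit point \<open>v\<close> in this cone.
  The maximum and the minimum of \<open>L\<^sub>s f / f\<close> are monotone along the iterates, so both of them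
  are constant along the iterates of \<open>v\<close>; this forces \<open>L\<^sub>s v / v\<close> to attain its maximum and its
  minimum at \<open>\<theta>\<^sup>m z\<close> and \<open>\<theta>\<^sup>m z'\<close> for every \<open>m\<close>, with suitable \<open>z\<close>, \<open>z'\<close> depending on \<open>m\<close>,
  where \<open>\<theta>\<close> is a contracting branch. So \<open>L\<^sub>s v / v\<close> is constant. The same argument
  applied to the quotient of two positive eigenfunctions gives uniqueness, and symmetry follows
  from uniqueness.
\<close>

section \<open>The kernels\<close>

text \<open>Plays two roles: for \<open>\<xi>\<close> in \<open>B\<close> it is a weight of the
  operator, for general \<open>\<xi>\<close> a generator of the invariant cone.\<close>

definition kern :: "real \<Rightarrow> complex \<Rightarrow> complex \<Rightarrow> real" where
  "kern s \<xi> z = norm (z + \<xi>) powr (- 2 * s)"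

text \<open>Values lie in an arbitrary Banach space, so that the same lemmas serve complex functions
  and the real ones to which order arguments apply.\<close>

definition transfer :: "real \<Rightarrow> complex set \<Rightarrow> (complex \<Rightarrow> 'a::banach) \<Rightarrow> complex \<Rightarrow> 'a" where
  "transfer s B f z = (\<Sum>\<^sub>\<infinity>b\<in>B. kern s b z *\<^sub>R f (1 / (z + b)))"

lemma kern_nonneg: "kern s \<xi> z \<ge> 0"
  by (simp add: kern_def)

lemma scaleR_kern_eq_divide:
  "kern s b z *\<^sub>R (c :: complex) = c / complex_of_real (norm (z + b) powr (2 * s))"
  by (simp add: kern_def powr_minus scaleR_conv_of_real divide_inverse mult.commute)

lemma Lop_eq_transfer: "Lop s B f = transfer s B f"
  unfolding Lop_def transfer_def scaleR_kern_eq_divide by (rule refl)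

section \<open>Estimates for kernels and branches on the right half-plane\<close>

lemma norm_add_ge:
  assumes "Re \<xi> \<ge> \<gamma>" "Re z \<ge> 0"
  shows "norm (z + \<xi>) \<ge> \<gamma>"
  using complex_Re_le_cmod[of "z + \<xi>"] assms by simp

lemma kern_pos:
  assumes "\<gamma> > 0" "Re \<xi> \<ge> \<gamma>" "Re z \<ge> 0"
  shows "kern s \<xi> z > 0"
proof -
  have "z + \<xi> \<noteq> 0" using norm_add_ge[OF assms(2,3)] assms(1) by auto
  then show ?thesis by (simp add: kern_def)
qed

text \<open>Since \<open>norm (z + \<xi>) \<ge> \<gamma>\<close>, moving the point by
  \<open>d\<close> stretches the modulus by at most
  \<open>1 + d / \<gamma> \<le> exp (d / \<gamma>)\<close>; then take the power
  \<open>- 2 * s\<close>.\<close>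

lemma kern_log_Lipschitz:
  assumes "\<gamma> > 0" "s > 0" "Re \<xi> \<ge> \<gamma>" "Re z \<ge> 0" "Re w \<ge> 0"
  shows "kern s \<xi> z \<le> exp (2 * s / \<gamma> * norm (z - w)) * kern s \<xi> w"
proof -
  let ?d = "norm (z - w)"
  have z: "norm (z + \<xi>) \<ge> \<gamma>" and w: "norm (w + \<xi>) \<ge> \<gamma>"
    using norm_add_ge assms by auto
  have "norm (w + \<xi>) \<le> norm (z + \<xi>) + ?d"
    using norm_triangle_ineq4[of "z + \<xi>" "z - w"] by (simp add: algebra_simps)
  also have "\<dots> \<le> norm (z + \<xi>) * (1 + ?d / \<gamma>)"
    using z assms(1) mult_right_mono[OF z, of ?d] by (simp add: field_simps)
  also have "\<dots> \<le> norm (z + \<xi>) * exp (?d / \<gamma>)"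
    using exp_ge_add_one_self[of "?d / \<gamma>"] by (intro mult_left_mono) auto
  finally have le: "norm (w + \<xi>) \<le> norm (z + \<xi>) * exp (?d / \<gamma>)" .
  have "(norm (z + \<xi>) * exp (?d / \<gamma>)) powr (- 2 * s) \<le> norm (w + \<xi>) powr (- 2 * s)"
    using le w assms by (intro powr_mono2') auto
  also have "(norm (z + \<xi>) * exp (?d / \<gamma>)) powr (- 2 * s)
      = kern s \<xi> z * exp (- (2 * s / \<gamma> * ?d))"
    by (simp add: kern_def powr_mult exp_powr_real field_simps)
  finally show ?thesis
    by (simp add: kern_def exp_minus field_simps)
qed

lemma kern_antimono_Re:
  assumes "\<gamma> > 0" "s > 0" "Re \<xi> \<ge> \<gamma>" "0 \<le> x1" "x1 \<le> x2"
  shows "kern s \<xi> (Complex x2 y) \<le> kern s \<xi> (Complex x1 y)"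
proof -
  have "norm (Complex x1 y + \<xi>) \<ge> \<gamma>" using norm_add_ge assms by auto
  moreover have "norm (Complex x1 y + \<xi>) \<le> norm (Complex x2 y + \<xi>)"
    using assms by (auto simp: cmod_def intro!: power_mono)
  ultimately show ?thesis
    unfolding kern_def using assms by (intro powr_mono2') auto
qed

text \<open>The constant is half of the one for general directions, because
  \<open>2 * \<bar>t\<bar> / (a\<^sup>2 + t\<^sup>2) \<le> 1 / a\<close>.\<close>

lemma kern_log_Lipschitz_Im:
  assumes "\<gamma> > 0" "s > 0" "Re \<xi> \<ge> \<gamma>" "0 \<le> x"
  shows "kern s \<xi> (Complex x y1) \<le> exp (s / \<gamma> * \<bar>y1 - y2\<bar>) * kern s \<xi> (Complex x y2)"
proof -
  define a where "a = x + Re \<xi>"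
  \<comment> \<open>The squared modulus turns the kernel into \<open>exp (- s * ln (q y))\<close>,
    so it suffices to bound the derivative of \<open>ln (q y)\<close> by
    \<open>1 / \<gamma>\<close>.\<close>
  define q where "q = (\<lambda>y. a\<^sup>2 + (y + Im \<xi>)\<^sup>2)"
  have a: "a \<ge> \<gamma>" "a > 0" using assms by (auto simp: a_def)
  have q: "q y > 0" for y using a by (simp add: q_def add_pos_nonneg)
  have kern: "kern s \<xi> (Complex x y) = exp (- s * ln (q y))" for y
  proof -
    have n: "norm (Complex x y + \<xi>) = sqrt (q y)" by (simp add: cmod_def q_def a_def)
    show ?thesis
      unfolding kern_def n using q[of y] by (simp add: powr_def ln_sqrt)
  qed
  have "norm (ln (q y2) - ln (q y1)) \<le> 1 / \<gamma> * norm (y2 - y1)"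
  proof (rule field_differentiable_bound[where S = UNIV and f' = "\<lambda>y. 2 * (y + Im \<xi>) / q y"])
    show "((\<lambda>y. ln (q y)) has_field_derivative 2 * (z + Im \<xi>) / q z) (at z within UNIV)" for z
      using q[of z] unfolding q_def
      by (auto intro!: derivative_eq_intros simp: field_simps)
    show "norm (2 * (z + Im \<xi>) / q z) \<le> 1 / \<gamma>" for z
    proof -
      define t where "t = z + Im \<xi>"
      have "2 * \<bar>t\<bar> * a \<le> q z"
        using sum_squares_bound[of a "\<bar>t\<bar>"] by (simp add: q_def t_def mult.commute mult.left_commute)
      moreover have "2 * \<bar>t\<bar> * \<gamma> \<le> 2 * \<bar>t\<bar> * a"
        using a by (intro mult_left_mono) auto
      ultimately show ?thesis
        unfolding t_def[symmetric] using q[of z] assms(1) by (simp add: abs_mult field_simps)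
    qed
  qed auto
  then have "s * (ln (q y2) - ln (q y1)) \<le> s * (1 / \<gamma> * \<bar>y1 - y2\<bar>)"
    using assms(2) by (intro mult_left_mono) (auto simp: abs_minus_commute)
  then have "- s * ln (q y1) \<le> s / \<gamma> * \<bar>y1 - y2\<bar> + (- s * ln (q y2))"
    by (simp add: algebra_simps)
  then show ?thesis
    unfolding kern exp_add[symmetric] by simp
qed

text \<open>From \<open>(z + b) * (1 / (z + b) + \<xi>) = \<xi> * (z + (b + 1 / \<xi>))\<close>.
  Each term of the operator thus turns a kernel into a positive multiple of a kernel, which makes
  the cone invariant.\<close>

lemma kern_inverse_add:
  assumes "\<xi> \<noteq> 0" "z + b \<noteq> 0"
  shows "kern s b z * kern s \<xi> (1 / (z + b)) = kern s \<xi> 0 * kern s (b + 1 / \<xi>) z"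
proof -
  have "norm (z + b) * norm (1 / (z + b) + \<xi>) = norm \<xi> * norm (z + (b + 1 / \<xi>))"
  proof -
    have "(z + b) * (1 / (z + b) + \<xi>) = \<xi> * (z + (b + 1 / \<xi>))"
      using assms by (simp add: distrib_left mult.commute)
    then show ?thesis unfolding norm_mult[symmetric] by simp
  qed
  then show ?thesis
    unfolding kern_def by (simp add: powr_mult[symmetric] add.commute)
qed

text \<open>The distance from \<open>1 / w\<close> to the centre is
  \<open>norm (w - 2 * \<gamma>) / (2 * \<gamma> * norm w)\<close>, so membership means that
  \<open>w\<close> is no farther from \<open>2 * \<gamma>\<close> than from \<open>0\<close>, which
  is \<open>Re w \<ge> \<gamma>\<close>.\<close>

lemma inverse_in_disk:
  assumes "\<gamma> > 0" "Re w \<ge> \<gamma>"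
  shows "1 / w \<in> cball (complex_of_real (1 / (2 * \<gamma>))) (1 / (2 * \<gamma>))"
proof -
  have w: "w \<noteq> 0" using assms by auto
  have "norm (w - complex_of_real (2 * \<gamma>)) \<le> norm w"
  proof -
    have "(Re w - 2 * \<gamma>)\<^sup>2 \<le> (Re w)\<^sup>2"
    proof -
      have "(Re w)\<^sup>2 - (Re w - 2 * \<gamma>)\<^sup>2 = 4 * \<gamma> * (Re w - \<gamma>)" by (simp add: power2_eq_square algebra_simps)
      also have "\<dots> \<ge> 0" using assms by simp
      finally show ?thesis by simp
    qed
    then show ?thesis by (simp add: cmod_def)
  qed
  moreover have "complex_of_real (1 / (2 * \<gamma>)) - 1 / w = (w - complex_of_real (2 * \<gamma>)) / (w * complex_of_real (2 * \<gamma>))"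
    using w assms by (simp add: field_simps)
  ultimately show ?thesis
    using w assms by (simp add: dist_norm norm_divide norm_mult field_simps)
qed

text \<open>Otherwise infinitely many terms are at least \<open>C powr (- r)\<close>, and enough of
  them exceed the sum. This supplies a parameter so large that its branch contracts.\<close>

lemma infinite_summable_unbounded:
  fixes B :: "complex set"
  assumes "infinite B" "(\<lambda>b. norm b powr (- r)) summable_on B" "r > 0" "0 \<notin> B"
  shows "\<exists>b\<in>B. norm b \<ge> C"
proof (rule ccontr)
  assume "\<not> ?thesis"
  then have less: "norm b < C" if "b \<in> B" for b using that by force
  define \<epsilon> where "\<epsilon> = C powr (- r)"
  obtain b where "b \<in> B" using assms(1) by fastforce
  with less[of b] have "C > 0" by (meson le_less_trans norm_ge_zero)
  then have e: "\<epsilon> > 0" by (simp add: \<epsilon>_def)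
  define S where "S = (\<Sum>\<^sub>\<infinity>b\<in>B. norm b powr (- r))"
  obtain n :: nat where n: "real n * \<epsilon> > S" using ex_less_of_nat_mult[OF e] by auto
  obtain X where X: "X \<subseteq> B" "finite X" "card X = n"
    using infinite_arbitrarily_large[OF assms(1)] by blast
  have "real n * \<epsilon> \<le> (\<Sum>b\<in>X. norm b powr (- r))"
    unfolding X(3)[symmetric]
  proof (rule sum_bounded_below)
    fix b assume b: "b \<in> X"
    then have "b \<in> B" "b \<noteq> 0" using X(1) assms(4) by auto
    then show "\<epsilon> \<le> norm b powr (- r)"
      unfolding \<epsilon>_def using less[of b] assms(3) by (intro powr_mono2') auto
  qed
  also have "\<dots> \<le> S"
    unfolding S_def using assms X by (intro finite_sum_le_infsum) auto
  finally show False using n by simp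
qed

section \<open>The transfer operator\<close>

text \<open>\<open>K\<close> stands for the closure of \<open>H\<close>. The disk contains all
  branch images of \<open>K\<close>, so the branches preserve \<open>K\<close>; the size of
  \<open>b0\<close> keeps \<open>norm (z + b0) \<ge> 2\<close> on \<open>K\<close>.\<close>

locale transfer_setting =
  fixes \<gamma> s R :: real and B K :: "complex set" and b0 :: complex
  assumes gamma: "\<gamma> \<ge> 1" and s: "s > 0"
    and B: "\<And>b. b \<in> B \<Longrightarrow> Re b \<ge> \<gamma>"
    and summable: "(\<lambda>b. norm b powr (- 2 * s)) summable_on B"
    and compact: "compact K"
    and K: "\<And>z. z \<in> K \<Longrightarrow> Re z \<ge> 0" and R: "\<And>z. z \<in> K \<Longrightarrow> norm z \<le> R"
    and disk: "cball (complex_of_real (1 / (2 * \<gamma>))) (1 / (2 * \<gamma>)) \<subseteq> K"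
    and b0: "b0 \<in> B" "norm b0 \<ge> R + 2"
begin

abbreviation (input) L :: "(complex \<Rightarrow> 'a::banach) \<Rightarrow> complex \<Rightarrow> 'a" where
  "L \<equiv> transfer s B"

text \<open>Base point for normalising the iterates. Being real it is fixed by conjugation, which
  later determines the scalar in the symmetry claim.\<close>

definition p :: complex where "p = complex_of_real (1 / (2 * \<gamma>))"

lemma p_in: "p \<in> K"
  using disk gamma by (auto simp: p_def)

lemma R_nonneg: "R \<ge> 0"
  using R[OF p_in] norm_ge_zero[of p] by linarith

lemma branch_in: "b \<in> B \<Longrightarrow> z \<in> K \<Longrightarrow> 1 / (z + b) \<in> K"
  using inverse_in_disk[of \<gamma> "z + b"] gamma B[of b] K[of z] disk by auto

lemma branch_nz: "b \<in> B \<Longrightarrow> z \<in> K \<Longrightarrow> z + b \<noteq> 0"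
  using norm_add_ge[OF B K, of b z] gamma by auto

section \<open>Weierstrass majorants and boundedness on \<open>K\<close>\<close>

definition wbound :: "complex \<Rightarrow> real" where
  "wbound b = (1 + R) powr (2 * s) * norm b powr (- 2 * s)"

definition opbound :: real where
  "opbound = (\<Sum>\<^sub>\<infinity>b\<in>B. wbound b)"

text \<open>As \<open>norm (z + b) \<ge> 1\<close>, one has
  \<open>norm b \<le> norm (z + b) + R \<le> (1 + R) * norm (z + b)\<close>; this removes
  \<open>z\<close> from the bound.\<close>

lemma kern_le_wbound:
  assumes "b \<in> B" "z \<in> K"
  shows "kern s b z \<le> wbound b"
proof -
  have ge1: "norm (z + b) \<ge> 1" using norm_add_ge[OF B K, OF assms] gamma by linarith
  have nb: "norm b > 0" using B[OF assms(1)] gamma by auto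
  have "norm b \<le> norm (z + b) + norm z"
    using norm_triangle_ineq4[of "z + b" z] by simp
  also have "\<dots> \<le> norm (z + b) + R * norm (z + b)"
    using R[OF assms(2)] mult_left_mono[OF ge1 R_nonneg] by simp
  finally have "norm b / (1 + R) \<le> norm (z + b)"
    using R_nonneg by (simp add: field_simps)
  then have "norm (z + b) powr (- 2 * s) \<le> (norm b / (1 + R)) powr (- 2 * s)"
    using nb R_nonneg s by (intro powr_mono2') auto
  also have "\<dots> = wbound b"
    using R_nonneg nb by (simp add: wbound_def powr_divide powr_minus field_simps)
  finally show ?thesis by (simp add: kern_def)
qed

lemma wbound_summable: "wbound summable_on B"
  unfolding wbound_def by (intro summable_on_cmult_right summable)

lemma bounded_on_K:
  fixes f :: "complex \<Rightarrow> 'a::banach"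
  assumes "continuous_on K f"
  obtains m where "m \<ge> 0" "\<And>z. z \<in> K \<Longrightarrow> norm (f z) \<le> m"
proof -
  have "bounded (f ` K)"
    by (intro compact_imp_bounded compact_continuous_image assms compact)
  then obtain m where m: "\<And>z. z \<in> K \<Longrightarrow> norm (f z) \<le> m" by (auto simp: bounded_iff)
  with that[of m] show ?thesis using m[OF p_in] norm_ge_zero[of "f p"] by force
qed

lemma term_bound:
  fixes f :: "complex \<Rightarrow> 'a::banach"
  assumes "\<And>z. z \<in> K \<Longrightarrow> norm (f z) \<le> m" "b \<in> B" "z \<in> K"
  shows "norm (kern s b z *\<^sub>R f (1 / (z + b))) \<le> wbound b * m"
  using mult_mono[OF kern_le_wbound[OF assms(2,3)] assms(1)[OF branch_in[OF assms(2,3)]]]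
    kern_nonneg[of s b z] kern_le_wbound[OF assms(2,3)] by (auto simp: kern_def)

lemma terms_summable:
  fixes f :: "complex \<Rightarrow> 'a::banach"
  assumes "continuous_on K f" "z \<in> K"
  shows "(\<lambda>b. kern s b z *\<^sub>R f (1 / (z + b))) summable_on B"
proof -
  obtain m where m: "\<And>z. z \<in> K \<Longrightarrow> norm (f z) \<le> m" using bounded_on_K[OF assms(1)] by blast
  show ?thesis
    by (rule abs_summable_summable, rule Infinite_Sum.abs_summable_on_comparison_test'[where g = "\<lambda>b. wbound b * m"])
      (use wbound_summable term_bound[OF m] assms(2) in \<open>auto intro: summable_on_cmult_left\<close>)
qed

lemma transfer_has_sum:
  fixes f :: "complex \<Rightarrow> 'a::banach"
  assumes "continuous_on K f" "z \<in> K"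
  shows "((\<lambda>b. kern s b z *\<^sub>R f (1 / (z + b))) has_sum L f z) B"
  unfolding transfer_def using terms_summable[OF assms] by (rule has_sum_infsum)

text \<open>The M-test with majorants \<open>wbound b * m\<close>. Uniformity gives continuity of
  the image, and later places the image of a kernel in the closed cone.\<close>

lemma transfer_uniform_limit:
  fixes f :: "complex \<Rightarrow> 'a::banach"
  assumes "continuous_on K f"
  shows "uniform_limit K (\<lambda>X z. \<Sum>b\<in>X. kern s b z *\<^sub>R f (1 / (z + b))) (L f) (finite_subsets_at_top B)"
proof -
  obtain m where m: "\<And>z. z \<in> K \<Longrightarrow> norm (f z) \<le> m" using bounded_on_K[OF assms(1)] by blast
  show ?thesis
    by (rule Weierstrass_m_test_general'[where M = "\<lambda>b. wbound b * m"])
      (use term_bound[OF m] transfer_has_sum[OF assms] wbound_summable in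
        \<open>auto intro: summable_on_cmult_left\<close>)
qed

lemma continuous_on_transfer:
  fixes f :: "complex \<Rightarrow> 'a::banach"
  assumes "continuous_on K f"
  shows "continuous_on K (L f)"
proof (rule uniform_limit_theorem[OF _ transfer_uniform_limit[OF assms]])
  show "\<forall>\<^sub>F X in finite_subsets_at_top B.
      continuous_on K (\<lambda>z. \<Sum>b\<in>X. kern s b z *\<^sub>R f (1 / (z + b)))"
  proof (rule eventually_finite_subsets_at_top_weakI)
    fix X assume X: "finite X" "X \<subseteq> B"
    have "continuous_on K (\<lambda>z. kern s b z *\<^sub>R f (1 / (z + b)))" if "b \<in> B" for b
    proof -
      have nz: "\<forall>z\<in>K. z + b \<noteq> 0" using branch_nz that by auto
      have "continuous_on K (f \<circ> (\<lambda>z. 1 / (z + b)))"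
        by (intro continuous_on_compose continuous_on_subset[OF assms] continuous_intros)
          (use nz branch_in that in auto)
      then show ?thesis
        unfolding kern_def o_def using nz by (intro continuous_intros) auto
    qed
    with X show "continuous_on K (\<lambda>z. \<Sum>b\<in>X. kern s b z *\<^sub>R f (1 / (z + b)))"
      by (intro continuous_on_sum) auto
  qed
qed auto

lemma norm_transfer_le:
  fixes f :: "complex \<Rightarrow> 'a::banach"
  assumes "continuous_on K f" "\<And>z. z \<in> K \<Longrightarrow> norm (f z) \<le> m" "z \<in> K"
  shows "norm (L f z) \<le> opbound * m"
proof (rule norm_infsum_le[OF transfer_has_sum[OF assms(1,3)]])
  show "((\<lambda>b. wbound b * m) has_sum opbound * m) B"
    unfolding opbound_def by (intro has_sum_cmult_left has_sum_infsum wbound_summable)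
qed (use term_bound[OF assms(2)] assms(3) in auto)

lemma opbound_nonneg: "opbound \<ge> 0"
  unfolding opbound_def by (intro infsum_nonneg) (simp add: wbound_def)

section \<open>Linearity, positivity and continuity of the operator\<close>

lemma transfer_cong:
  assumes "\<And>z. z \<in> K \<Longrightarrow> f z = g z" "z \<in> K"
  shows "L f z = L g z"
  unfolding transfer_def by (intro infsum_cong) (simp add: assms branch_in)

lemma transfer_add:
  fixes f g :: "complex \<Rightarrow> 'a::banach"
  assumes "continuous_on K f" "continuous_on K g" "z \<in> K"
  shows "L (\<lambda>w. f w + g w) z = L f z + L g z"
  unfolding transfer_def scaleR_add_right
  by (intro infsum_add terms_summable assms)

text \<open>Sums commute with bounded linear maps; this covers both homogeneity and the passage from
  real to complex functions.\<close>

lemma transfer_bounded_linear: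
  fixes f :: "complex \<Rightarrow> 'a::banach" and h :: "'a \<Rightarrow> 'b::banach"
  assumes "bounded_linear h" "continuous_on K f" "z \<in> K"
  shows "L (\<lambda>w. h (f w)) z = h (L f z)"
proof -
  interpret h: bounded_linear h by fact
  have "((\<lambda>b. kern s b z *\<^sub>R h (f (1 / (z + b)))) has_sum h (L f z)) B"
    using has_sum_bounded_linear[OF assms(1) transfer_has_sum[OF assms(2,3)]]
    by (simp add: h.scaleR)
  then show ?thesis unfolding transfer_def by (rule infsumI)
qed

lemmas transfer_scale = transfer_bounded_linear[OF bounded_linear_mult_right]
lemmas transfer_of_real = transfer_bounded_linear[OF bounded_linear_of_real]

lemma transfer_diff:
  fixes f g :: "complex \<Rightarrow> real"
  assumes "continuous_on K f" "continuous_on K g" "z \<in> K"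
  shows "L (\<lambda>w. f w - g w) z = L f z - L g z"
  using transfer_add[OF assms(1) continuous_on_minus[OF assms(2)] assms(3)]
    transfer_scale[OF assms(2,3), of "-1"] by simp

text \<open>Keeping a single nonnegative term yields strict positivity, and lets a zero of the image
  be traced back to a zero of the function.\<close>

lemma transfer_ge_term:
  fixes f :: "complex \<Rightarrow> real"
  assumes "continuous_on K f" "\<And>z. z \<in> K \<Longrightarrow> f z \<ge> 0" "z \<in> K" "b \<in> B"
  shows "L f z \<ge> kern s b z * f (1 / (z + b))"
proof -
  have "(\<Sum>b\<in>{b}. kern s b z *\<^sub>R f (1 / (z + b))) \<le> L f z"
    unfolding transfer_def using terms_summable[OF assms(1,3)] assms(2-4) branch_in
    by (intro finite_sum_le_infsum) (auto simp: kern_nonneg)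
  then show ?thesis by simp
qed

lemma kern_branch_pos: "b \<in> B \<Longrightarrow> z \<in> K \<Longrightarrow> kern s b z > 0"
  using kern_pos[of \<gamma> b z s] B[of b] K[of z] gamma by auto

lemma transfer_nonneg:
  fixes f :: "complex \<Rightarrow> real"
  assumes "\<And>z. z \<in> K \<Longrightarrow> f z \<ge> 0" "z \<in> K"
  shows "L f z \<ge> 0"
  unfolding transfer_def by (intro infsum_nonneg) (simp add: assms branch_in kern_nonneg)

lemma transfer_pos:
  fixes f :: "complex \<Rightarrow> real"
  assumes "continuous_on K f" "\<And>z. z \<in> K \<Longrightarrow> f z > 0" "z \<in> K"
  shows "L f z > 0"
proof -
  have "kern s b0 z * f (1 / (z + b0)) > 0"
    using assms(2)[OF branch_in] kern_branch_pos b0 assms(3) by simp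
  also have "\<dots> \<le> L f z"
    using assms less_imp_le b0 by (intro transfer_ge_term) blast+
  finally show ?thesis .
qed

lemma transfer_mono:
  fixes f g :: "complex \<Rightarrow> real"
  assumes "continuous_on K f" "continuous_on K g" "\<And>z. z \<in> K \<Longrightarrow> f z \<le> g z" "z \<in> K"
  shows "L f z \<le> L g z"
  using transfer_nonneg[of "\<lambda>w. g w - f w" z] transfer_diff[OF assms(2,1,4)] assms(3,4) by simp

lemma transfer_tendsto_uniform:
  fixes f :: "nat \<Rightarrow> complex \<Rightarrow> real"
  assumes "\<And>k. continuous_on K (f k)" "continuous_on K g" "uniform_limit K f g sequentially"
  shows "uniform_limit K (\<lambda>k. L (f k)) (L g) sequentially"
proof (rule uniform_limitI)
  fix e :: real assume e: "e > 0"
  \<comment> \<open>The \<open>+ 1\<close> keeps the denominator positive and makes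
    \<open>opbound * d < e\<close> strict.\<close>
  define d where "d = e / (opbound + 1)"
  have d: "d > 0" "opbound * d < e" using e opbound_nonneg by (auto simp: d_def field_simps)
  have "\<forall>\<^sub>F k in sequentially. \<forall>z\<in>K. dist (f k z) (g z) < d"
    using uniform_limitD[OF assms(3) d(1)] .
  then show "\<forall>\<^sub>F k in sequentially. \<forall>z\<in>K. dist (L (f k) z) (L g z) < e"
  proof eventually_elim
    case (elim k)
    show ?case
    proof
      fix z assume z: "z \<in> K"
      have "norm (L (\<lambda>w. f k w - g w) z) \<le> opbound * d"
        by (rule norm_transfer_le)
          (use assms elim z in \<open>auto intro!: continuous_intros simp: dist_real_def less_imp_le\<close>)
      then show "dist (L (f k) z) (L g z) < e"
        using transfer_diff[OF assms(1,2) z] d by (simp add: dist_real_def)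
    qed
  qed
qed

section \<open>Iterates of the operator\<close>

lemma iterate_continuous:
  fixes f :: "complex \<Rightarrow> real"
  assumes "continuous_on K f"
  shows "continuous_on K ((L ^^ m) f)"
  by (induction m) (simp_all add: assms continuous_on_transfer)

lemma iterate_tendsto_uniform:
  fixes f :: "nat \<Rightarrow> complex \<Rightarrow> real"
  assumes "\<And>k. continuous_on K (f k)" "continuous_on K g" "uniform_limit K f g sequentially"
  shows "uniform_limit K (\<lambda>k. (L ^^ m) (f k)) ((L ^^ m) g) sequentially"
  by (induction m) (simp_all add: assms iterate_continuous transfer_tendsto_uniform)

lemma iterate_scale:
  fixes f :: "complex \<Rightarrow> real"
  assumes "continuous_on K f"
  shows "z \<in> K \<Longrightarrow> (L ^^ m) (\<lambda>w. c * f w) z = c * (L ^^ m) f z"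
proof (induction m arbitrary: z)
  case (Suc m)
  then show ?case
    using transfer_cong[of "(L ^^ m) (\<lambda>w. c * f w)" "\<lambda>w. c * (L ^^ m) f w" z]
      transfer_scale[OF iterate_continuous[OF assms], of z c m] by simp
qed simp

lemma iterate_diff:
  fixes f g :: "complex \<Rightarrow> real"
  assumes "continuous_on K f" "continuous_on K g"
  shows "z \<in> K \<Longrightarrow> (L ^^ m) (\<lambda>w. f w - g w) z = (L ^^ m) f z - (L ^^ m) g z"
proof (induction m arbitrary: z)
  case (Suc m)
  then show ?case
    using transfer_cong[of "(L ^^ m) (\<lambda>w. f w - g w)" "\<lambda>w. (L ^^ m) f w - (L ^^ m) g w" z]
      transfer_diff[OF iterate_continuous[OF assms(1)] iterate_continuous[OF assms(2)], of z m m] by simp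
qed simp

section \<open>The contracting branch and its deep images\<close>

definition \<theta> :: "complex \<Rightarrow> complex" where
  "\<theta> z = 1 / (z + b0)"

lemma theta_iterate_in: "z \<in> K \<Longrightarrow> (\<theta> ^^ n) z \<in> K"
  by (induction n) (simp_all add: \<theta>_def branch_in b0)

lemma iterate_nonneg:
  fixes f :: "complex \<Rightarrow> real"
  assumes "\<And>z. z \<in> K \<Longrightarrow> f z \<ge> 0"
  shows "z \<in> K \<Longrightarrow> (L ^^ m) f z \<ge> 0"
  by (induction m arbitrary: z) (auto simp: assms intro: transfer_nonneg)

text \<open>A vanishing sum of nonnegative terms has a vanishing \<open>b0\<close> term, whose
  weight is positive. So the zero moves from \<open>z\<close> to \<open>\<theta> z\<close> while one
  application of \<open>L\<close> is removed.\<close>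

lemma iterate_zero_imp:
  fixes f :: "complex \<Rightarrow> real"
  assumes "continuous_on K f" "\<And>z. z \<in> K \<Longrightarrow> f z \<ge> 0"
  shows "z \<in> K \<Longrightarrow> (L ^^ m) f z = 0 \<Longrightarrow> f ((\<theta> ^^ m) z) = 0"
proof (induction m arbitrary: z)
  case (Suc m)
  have "kern s b0 z * (L ^^ m) f (1 / (z + b0)) \<le> 0"
    using transfer_ge_term[OF iterate_continuous[OF assms(1)] iterate_nonneg[OF assms(2)] Suc.prems(1) b0(1), of m]
      Suc.prems(2) by simp
  then have "(L ^^ m) f (1 / (z + b0)) \<le> 0"
    using kern_branch_pos[OF b0(1) Suc.prems(1)] by (simp add: mult_le_0_iff)
  moreover have in_K: "1 / (z + b0) \<in> K" using branch_in b0 Suc.prems by simp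
  ultimately have "(L ^^ m) f (1 / (z + b0)) = 0"
    using iterate_nonneg[OF assms(2)] by (meson order_antisym)
  from Suc.IH[OF in_K this] show ?case
    unfolding funpow_Suc_right o_apply \<theta>_def[of z] .
qed simp

text \<open>The difference is \<open>(w - z) / ((z + b0) * (w + b0))\<close>, and both factors below
  have modulus at least 2.\<close>

lemma theta_contraction:
  assumes "z \<in> K" "w \<in> K"
  shows "dist (\<theta> z) (\<theta> w) \<le> dist z w / 4"
proof -
  have two: "norm (z + b0) \<ge> 2" if "z \<in> K" for z
    using norm_triangle_ineq4[of "z + b0" z] R[OF that] b0 by simp
  have "\<theta> z - \<theta> w = (w - z) / ((z + b0) * (w + b0))"
    using branch_nz b0 assms by (simp add: \<theta>_def field_simps)
  then have "dist (\<theta> z) (\<theta> w) = dist z w / (norm (z + b0) * norm (w + b0))"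
    by (simp add: dist_norm norm_divide norm_mult norm_minus_commute)
  also have "\<dots> \<le> dist z w / (2 * 2)"
    using two assms branch_nz b0 by (intro divide_left_mono mult_mono mult_pos_pos) auto
  finally show ?thesis by simp
qed

lemma theta_iterate_contraction:
  assumes "z \<in> K" "w \<in> K"
  shows "dist ((\<theta> ^^ n) z) ((\<theta> ^^ n) w) \<le> dist z w * (1 / 4) ^ n"
proof (induction n)
  case (Suc n)
  then show ?case
    using theta_contraction[OF theta_iterate_in[OF assms(1)] theta_iterate_in[OF assms(2)], of n n] by simp
qed simp

text \<open>The image of \<open>K\<close> under \<open>\<theta> ^^ m\<close> has diameter at most
  \<open>2 * R * (1 / 4) ^ m\<close>, so both values occur at arbitrarily close points; uniform
  continuity of \<open>h\<close> forces them to agree.\<close>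

lemma values_on_deep_images_eq:
  fixes h :: "complex \<Rightarrow> real"
  assumes h: "continuous_on K h"
    and \<alpha>: "\<And>m. \<exists>z\<in>K. h ((\<theta> ^^ m) z) = \<alpha>" and \<beta>: "\<And>m. \<exists>z\<in>K. h ((\<theta> ^^ m) z) = \<beta>"
  shows "\<alpha> = \<beta>"
proof (rule ccontr)
  assume "\<alpha> \<noteq> \<beta>"
  then have "dist \<alpha> \<beta> > 0" by simp
  moreover have "uniformly_continuous_on K h" by (rule compact_uniformly_continuous[OF h compact])
  ultimately obtain d where d: "d > 0"
    "\<And>z w. z \<in> K \<Longrightarrow> w \<in> K \<Longrightarrow> dist z w < d \<Longrightarrow> dist (h z) (h w) < dist \<alpha> \<beta>"
    unfolding uniformly_continuous_on_def by metis
  have "(\<lambda>n. 2 * R * (1 / 4) ^ n) \<longlonglongrightarrow> 2 * R * 0"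
    by (intro tendsto_mult tendsto_const LIMSEQ_power_zero) simp
  then have "\<forall>\<^sub>F n in sequentially. 2 * R * (1 / 4) ^ n < d"
    using d(1) by (intro order_tendstoD) auto
  then obtain n where n: "2 * R * (1 / 4) ^ n < d" by (auto simp: eventually_sequentially)
  obtain z w where zw: "z \<in> K" "h ((\<theta> ^^ n) z) = \<alpha>" "w \<in> K" "h ((\<theta> ^^ n) w) = \<beta>"
    using \<alpha>[of n] \<beta>[of n] by auto
  have "dist z w \<le> 2 * R"
    using norm_triangle_ineq4[of z w] R[OF zw(1)] R[OF zw(3)] by (simp add: dist_norm)
  then have "dist z w * (1 / 4) ^ n \<le> 2 * R * (1 / 4) ^ n" by (intro mult_right_mono) auto
  then have "dist ((\<theta> ^^ n) z) ((\<theta> ^^ n) w) < d"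
    using theta_iterate_contraction[OF zw(1,3), of n] n by linarith
  then show False
    using d(2)[OF theta_iterate_in[OF zw(1)] theta_iterate_in[OF zw(3)], of n n] zw by simp
qed

section \<open>The invariant cone\<close>

text \<open>Finite combinations only, built one kernel at a time, so that linear inequalities pass
  from the generators by rule induction. Series of kernels enter through the closure.\<close>

inductive kern_cone :: "(complex \<Rightarrow> real) \<Rightarrow> bool" where
  zero: "kern_cone (\<lambda>_. 0)"
| add_kern: "kern_cone f \<Longrightarrow> c \<ge> 0 \<Longrightarrow> Re \<xi> \<ge> \<gamma> \<Longrightarrow> kern_cone (\<lambda>z. f z + c * kern s \<xi> z)"

lemma continuous_on_kern: "Re \<xi> \<ge> \<gamma> \<Longrightarrow> continuous_on K (kern s \<xi>)"
  unfolding kern_def using norm_add_ge[of \<gamma> \<xi>] K gamma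
  by (intro continuous_intros) fastforce

lemma continuous_on_kern_cone: "kern_cone f \<Longrightarrow> continuous_on K f"
  by (induction rule: kern_cone.induct) (auto intro!: continuous_intros continuous_on_kern)

lemma kern_cone_kern: "Re \<xi> \<ge> \<gamma> \<Longrightarrow> kern_cone (kern s \<xi>)"
  using add_kern[OF zero, of 1 \<xi>] by simp

lemma kern_cone_add:
  assumes "kern_cone f" "kern_cone g"
  shows "kern_cone (\<lambda>z. f z + g z)"
  using assms(2)
proof (induction rule: kern_cone.induct)
  case (add_kern g c \<xi>)
  then show ?case using kern_cone.add_kern[of "\<lambda>z. f z + g z" c \<xi>] by (simp add: add.assoc)
qed (simp add: assms)

lemma kern_cone_scale:
  assumes "kern_cone f" "a \<ge> 0"
  shows "kern_cone (\<lambda>z. a * f z)"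
  using assms(1)
proof (induction rule: kern_cone.induct)
  case (add_kern g c \<xi>)
  then show ?case using kern_cone.add_kern[of "\<lambda>z. a * g z" "a * c" \<xi>] assms(2) by (simp add: algebra_simps)
qed (simp add: zero)

lemma kern_cone_sum:
  assumes "finite X" "\<And>b. b \<in> X \<Longrightarrow> kern_cone (f b)"
  shows "kern_cone (\<lambda>z. \<Sum>b\<in>X. f b z)"
  using assms by (induction X rule: finite_induct) (simp_all add: zero kern_cone_add)

text \<open>Uniform closure relative to \<open>K\<close>; values off \<open>K\<close> are left free,
  because \<open>L f\<close> on \<open>K\<close> depends only on \<open>f\<close> on
  \<open>K\<close>.\<close>

definition closed_kern_cone :: "(complex \<Rightarrow> real) \<Rightarrow> bool" where
  "closed_kern_cone f \<longleftrightarrow> (\<forall>e>0. \<exists>h. kern_cone h \<and> (\<forall>z\<in>K. \<bar>f z - h z\<bar> \<le> e))"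

lemma closed_kern_coneI: "kern_cone f \<Longrightarrow> closed_kern_cone f"
  unfolding closed_kern_cone_def by (auto intro!: exI[of _ f])

lemma closed_kern_cone_closed:
  assumes "\<And>e. e > 0 \<Longrightarrow> \<exists>h. closed_kern_cone h \<and> (\<forall>z\<in>K. \<bar>f z - h z\<bar> \<le> e)"
  shows "closed_kern_cone f"
  unfolding closed_kern_cone_def
proof (intro allI impI)
  fix e :: real assume e: "e > 0"
  then obtain h where h: "closed_kern_cone h" "\<And>z. z \<in> K \<Longrightarrow> \<bar>f z - h z\<bar> \<le> e / 2"
    using assms[of "e / 2"] by auto
  then obtain g where g: "kern_cone g" "\<And>z. z \<in> K \<Longrightarrow> \<bar>h z - g z\<bar> \<le> e / 2"
    using e unfolding closed_kern_cone_def by (meson half_gt_zero)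
  have "\<bar>f z - g z\<bar> \<le> e" if "z \<in> K" for z using h(2)[OF that] g(2)[OF that] by linarith
  with g(1) show "\<exists>h. kern_cone h \<and> (\<forall>z\<in>K. \<bar>f z - h z\<bar> \<le> e)" by blast
qed

lemma closed_kern_cone_cong:
  assumes "closed_kern_cone f" "\<And>z. z \<in> K \<Longrightarrow> g z = f z"
  shows "closed_kern_cone g"
  using assms by (intro closed_kern_cone_closed exI[of _ f]) auto

lemma closed_kern_cone_add:
  assumes "closed_kern_cone f" "closed_kern_cone g"
  shows "closed_kern_cone (\<lambda>z. f z + g z)"
  unfolding closed_kern_cone_def
proof (intro allI impI)
  fix e :: real assume e: "e > 0"
  obtain f' where f': "kern_cone f'" "\<And>z. z \<in> K \<Longrightarrow> \<bar>f z - f' z\<bar> \<le> e / 2"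
    using assms(1) e unfolding closed_kern_cone_def by (meson half_gt_zero)
  obtain g' where g': "kern_cone g'" "\<And>z. z \<in> K \<Longrightarrow> \<bar>g z - g' z\<bar> \<le> e / 2"
    using assms(2) e unfolding closed_kern_cone_def by (meson half_gt_zero)
  have "\<bar>f z + g z - (f' z + g' z)\<bar> \<le> e" if "z \<in> K" for z using f'(2)[OF that] g'(2)[OF that] by linarith
  with kern_cone_add[OF f'(1) g'(1)] show "\<exists>h. kern_cone h \<and> (\<forall>z\<in>K. \<bar>f z + g z - h z\<bar> \<le> e)"
    by (intro exI[of _ "\<lambda>z. f' z + g' z"]) auto
qed

lemma closed_kern_cone_scale:
  assumes "closed_kern_cone f" "c \<ge> 0"
  shows "closed_kern_cone (\<lambda>z. c * f z)"
proof (rule closed_kern_cone_closed)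
  fix e :: real assume e: "e > 0"
  define d where "d = e / (c + 1)"
  have d: "d > 0" "c * d \<le> e" using e assms(2) by (auto simp: d_def field_simps)
  obtain f' where f': "kern_cone f'" "\<And>z. z \<in> K \<Longrightarrow> \<bar>f z - f' z\<bar> \<le> d"
    using assms(1) d(1) unfolding closed_kern_cone_def by blast
  have "\<bar>c * f z - c * f' z\<bar> \<le> e" if "z \<in> K" for z
  proof -
    have "\<bar>c * f z - c * f' z\<bar> = c * \<bar>f z - f' z\<bar>"
      using assms(2) by (simp add: abs_mult flip: right_diff_distrib)
    also have "\<dots> \<le> c * d" using f'(2)[OF that] assms(2) by (intro mult_left_mono)
    finally show ?thesis using d(2) by linarith
  qed
  with closed_kern_coneI[OF kern_cone_scale[OF f'(1) assms(2)]]
  show "\<exists>h. closed_kern_cone h \<and> (\<forall>z\<in>K. \<bar>c * f z - h z\<bar> \<le> e)"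
    by (intro exI[of _ "\<lambda>z. c * f' z"]) auto
qed

text \<open>By \<open>kern_inverse_add\<close> the finite partial sums lie in the cone, and they
  converge uniformly on \<open>K\<close>.\<close>

lemma closed_kern_cone_transfer_kern:
  assumes \<xi>: "Re \<xi> \<ge> \<gamma>"
  shows "closed_kern_cone (L (kern s \<xi>))"
proof (rule closed_kern_cone_closed)
  fix e :: real assume e: "e > 0"
  let ?S = "\<lambda>X z. \<Sum>b\<in>X. kern s b z *\<^sub>R kern s \<xi> (1 / (z + b))"
  have "\<forall>\<^sub>F X in finite_subsets_at_top B. (finite X \<and> X \<subseteq> B) \<and> (\<forall>z\<in>K. dist (?S X z) (L (kern s \<xi>) z) < e)"
    by (rule eventually_conj[OF eventually_finite_subsets_at_top_weakI
      uniform_limitD[OF transfer_uniform_limit[OF continuous_on_kern[OF \<xi>]] e]]) simp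
  from eventually_happens'[OF finite_subsets_at_top_neq_bot this]
  obtain X where X: "finite X" "X \<subseteq> B" "\<And>z. z \<in> K \<Longrightarrow> dist (?S X z) (L (kern s \<xi>) z) < e"
    by blast
  define h where "h = (\<lambda>z. \<Sum>b\<in>X. kern s \<xi> 0 * kern s (b + 1 / \<xi>) z)"
  \<comment> \<open>Keeps the new parameters \<open>b + 1 / \<xi>\<close> in the half-plane of
    admissible ones.\<close>
  have "Re (1 / \<xi>) \<ge> 0" using \<xi> gamma by (simp add: Re_divide)
  then have "kern_cone h"
    unfolding h_def using X(1,2) B
    by (intro kern_cone_sum kern_cone_scale kern_cone_kern kern_nonneg) (auto intro: add_increasing2)
  moreover have "?S X z = h z" if "z \<in> K" for z
    unfolding h_def real_scaleR_def using X(2) branch_nz that \<xi> gamma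
    by (intro sum.cong refl kern_inverse_add) auto
  then have "\<forall>z\<in>K. \<bar>L (kern s \<xi>) z - h z\<bar> \<le> e"
    using X(3) by (auto simp: dist_real_def abs_minus_commute less_imp_le)
  ultimately show "\<exists>h. closed_kern_cone h \<and> (\<forall>z\<in>K. \<bar>L (kern s \<xi>) z - h z\<bar> \<le> e)"
    using closed_kern_coneI by blast
qed

lemma closed_kern_cone_transfer_kern_cone:
  assumes "kern_cone f"
  shows "closed_kern_cone (L f)"
  using assms
proof (induction rule: kern_cone.induct)
  case zero
  show ?case by (rule closed_kern_cone_cong[OF closed_kern_coneI[OF kern_cone.zero]]) (simp add: transfer_def)
next
  case (add_kern f c \<xi>)
  note cont = continuous_on_kern_cone[OF add_kern(1)] continuous_on_kern[OF add_kern(3)]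
  have "L (\<lambda>z. f z + c * kern s \<xi> z) z = L f z + c * L (kern s \<xi>) z" if "z \<in> K" for z
    using transfer_add[OF cont(1) continuous_on_mult_left[OF cont(2)] that, of c]
      transfer_scale[OF cont(2) that, of c] by simp
  with add_kern show ?case
    by (intro closed_kern_cone_cong[OF closed_kern_cone_add[OF add_kern.IH
      closed_kern_cone_scale[OF closed_kern_cone_transfer_kern]]]) auto
qed

text \<open>Boundedness of the operator carries a cone approximation of \<open>f\<close> over to one
  of \<open>L f\<close> in the closed cone.\<close>

lemma closed_kern_cone_transfer:
  assumes "continuous_on K f" "closed_kern_cone f"
  shows "closed_kern_cone (L f)"
proof (rule closed_kern_cone_closed)
  fix e :: real assume e: "e > 0"
  define d where "d = e / (opbound + 1)"
  have d: "d > 0" "opbound * d \<le> e" using e opbound_nonneg by (auto simp: d_def field_simps)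
  obtain h where h: "kern_cone h" "\<And>z. z \<in> K \<Longrightarrow> \<bar>f z - h z\<bar> \<le> d"
    using assms(2) d(1) unfolding closed_kern_cone_def by blast
  note cont = continuous_on_kern_cone[OF h(1)]
  have "\<bar>L f z - L h z\<bar> \<le> e" if "z \<in> K" for z
    using norm_transfer_le[of "\<lambda>w. f w - h w" d z] h(2) transfer_diff[OF assms(1) cont that]
      that d(2) continuous_on_diff[OF assms(1) cont] by simp
  with closed_kern_cone_transfer_kern_cone[OF h(1)]
  show "\<exists>h. closed_kern_cone h \<and> (\<forall>z\<in>K. \<bar>L f z - h z\<bar> \<le> e)" by blast
qed

text \<open>The common source of (i), (ii) and (iii): a two-point inequality that is linear in the
  function need only be checked on kernels. With \<open>\<kappa> \<ge> 0\<close> it survives uniform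
  limits.\<close>

lemma closed_kern_cone_le:
  assumes f: "closed_kern_cone f" and zw: "z \<in> K" "w \<in> K" and "\<kappa> \<ge> 0"
    and le: "\<And>\<xi>. Re \<xi> \<ge> \<gamma> \<Longrightarrow> kern s \<xi> z \<le> \<kappa> * kern s \<xi> w"
  shows "f z \<le> \<kappa> * f w"
proof (rule field_le_epsilon)
  fix e :: real assume e: "e > 0"
  \<comment> \<open>Chosen so that the error \<open>d\<close> at \<open>z\<close> and the error
    \<open>\<kappa> * d\<close> at \<open>w\<close> add up to \<open>e\<close>.\<close>
  define d where "d = e / (\<kappa> + 1)"
  have d: "d > 0" using e assms(4) by (simp add: d_def)
  have "d * (\<kappa> + 1) = e" using assms(4) by (simp add: d_def)
  then have de: "d + \<kappa> * d = e" by (simp add: distrib_left mult.commute)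
  obtain h where h: "kern_cone h" "\<And>z. z \<in> K \<Longrightarrow> \<bar>f z - h z\<bar> \<le> d"
    using f d unfolding closed_kern_cone_def by blast
  have "h z \<le> \<kappa> * h w"
    using h(1)
  proof (induction rule: kern_cone.induct)
    case (add_kern g c \<xi>)
    then show ?case using mult_left_mono[OF le[OF add_kern(3)] add_kern(2)] by (simp add: algebra_simps)
  qed simp
  moreover have "f z \<le> h z + d" using h(2)[OF zw(1)] by linarith
  moreover have "\<kappa> * h w \<le> \<kappa> * (f w + d)"
    using h(2)[OF zw(2)] assms(4) by (intro mult_left_mono) linarith+
  ultimately show "f z \<le> \<kappa> * f w + e" unfolding de[symmetric] distrib_left by linarith
qed

section \<open>Lipschitz bounds on the closed cone\<close>

lemma closed_kern_cone_log_Lipschitz: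
  assumes "closed_kern_cone f" "z \<in> K" "w \<in> K"
  shows "f z \<le> exp (2 * s / \<gamma> * norm (z - w)) * f w"
  by (rule closed_kern_cone_le[OF assms]) (use kern_log_Lipschitz K assms gamma s in auto)

definition Lip :: real where
  "Lip = 2 * s / \<gamma> * exp (2 * s / \<gamma> * (2 * R))"

lemma Lip_nonneg: "Lip \<ge> 0"
  using s gamma by (simp add: Lip_def)

text \<open>The logarithmic bound with exponent \<open>t\<close> gives
  \<open>f z - f w \<le> f w * (exp t - 1)\<close>. Here \<open>exp t - 1 \<le> t * exp t\<close>,
  and \<open>norm (z - w) \<le> 2 * R\<close> bounds the last exponential; that is the origin of
  \<open>Lip\<close>.\<close>

lemma closed_kern_cone_Lipschitz:
  assumes f: "closed_kern_cone f" and pos: "\<And>z. z \<in> K \<Longrightarrow> 0 \<le> f z" and V: "\<And>z. z \<in> K \<Longrightarrow> f z \<le> V"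
    and "z \<in> K" "w \<in> K"
  shows "\<bar>f z - f w\<bar> \<le> V * Lip * norm (z - w)"
proof -
  have one: "f z - f w \<le> V * Lip * norm (z - w)" if z: "z \<in> K" and w: "w \<in> K" for z w
  proof -
    define t where "t = 2 * s / \<gamma> * norm (z - w)"
    have t0: "t \<ge> 0" using s gamma by (simp add: t_def)
    have "1 - t \<le> exp (- t)" using exp_ge_add_one_self[of "- t"] by simp
    then have "(1 - t) * exp t \<le> exp (- t) * exp t" by (intro mult_right_mono) auto
    then have e1: "exp t - 1 \<le> t * exp t" by (simp add: algebra_simps flip: exp_add)
    have "norm (z - w) \<le> 2 * R"
      using norm_triangle_ineq4[of z w] R[OF z] R[OF w] by simp
    then have "t \<le> 2 * s / \<gamma> * (2 * R)" unfolding t_def using s gamma by (intro mult_left_mono) auto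
    then have "t * exp t \<le> t * exp (2 * s / \<gamma> * (2 * R))" using t0 by (intro mult_left_mono) auto
    also have "\<dots> = Lip * norm (z - w)" by (simp add: t_def Lip_def)
    finally have e2: "exp t - 1 \<le> Lip * norm (z - w)" using e1 by linarith
    have "f z - f w \<le> f w * (exp t - 1)"
      using closed_kern_cone_log_Lipschitz[OF f z w] by (simp add: t_def algebra_simps)
    also have "\<dots> \<le> V * (Lip * norm (z - w))"
      using e2 pos[OF w] V[OF w] t0 by (intro mult_mono) auto
    finally show ?thesis by simp
  qed
  show ?thesis
    using one[OF assms(4,5)] one[OF assms(5,4)] by (simp add: norm_minus_commute abs_le_iff)
qed

section \<open>The positive eigenfunction\<close>

definition u :: "nat \<Rightarrow> complex \<Rightarrow> real" where
  "u n = (L ^^ n) (kern s (complex_of_real \<gamma>))"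

lemma u_Suc: "u (Suc n) = L (u n)"
  by (simp add: u_def)

lemma continuous_on_u: "continuous_on K (u n)"
  unfolding u_def by (intro iterate_continuous continuous_on_kern) simp

lemma u_closed_kern_cone: "closed_kern_cone (u n)"
  by (induction n)
    (simp_all add: u_Suc continuous_on_u closed_kern_cone_transfer,
     simp add: u_def closed_kern_coneI kern_cone_kern)

lemma u_pos: "z \<in> K \<Longrightarrow> u n z > 0"
proof (induction n arbitrary: z)
  case 0
  then show ?case using kern_pos[of \<gamma> "complex_of_real \<gamma>" z s] gamma K by (simp add: u_def)
next
  case (Suc n)
  then show ?case unfolding u_Suc by (intro transfer_pos continuous_on_u)
qed

text \<open>A Harnack constant: it bounds the ratio of any two values of \<open>u n\<close> on
  \<open>K\<close>, uniformly in \<open>n\<close>.\<close>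

definition osc :: real where
  "osc = exp (2 * s / \<gamma> * (2 * R))"

lemma u_le:
  assumes "z \<in> K" "w \<in> K"
  shows "u n z \<le> osc * u n w"
proof -
  have "norm (z - w) \<le> 2 * R"
    using norm_triangle_ineq4[of z w] R[OF assms(1)] R[OF assms(2)] by simp
  then have "exp (2 * s / \<gamma> * norm (z - w)) \<le> osc"
    unfolding osc_def exp_le_cancel_iff using s gamma by (intro mult_left_mono) auto
  then have "exp (2 * s / \<gamma> * norm (z - w)) * u n w \<le> osc * u n w"
    using u_pos[OF assms(2), of n] by (intro mult_right_mono) auto
  with closed_kern_cone_log_Lipschitz[OF u_closed_kern_cone assms] show ?thesis by (rule order_trans)
qed

text \<open>The operator bound is applied with \<open>osc * u n z\<close> as upper bound of
  \<open>u n\<close> on \<open>K\<close>. This keeps the quotients of consecutive iterates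
  bounded.\<close>

lemma u_Suc_le:
  assumes "z \<in> K"
  shows "u (Suc n) z \<le> opbound * osc * u n z"
proof -
  have "norm (L (u n) z) \<le> opbound * (osc * u n z)"
    by (rule norm_transfer_le) (use continuous_on_u u_le u_pos assms in \<open>auto simp: abs_of_pos\<close>)
  then show ?thesis by (simp add: u_Suc)
qed

definition fnorm :: "nat \<Rightarrow> complex \<Rightarrow> real" where
  "fnorm n z = (1 / u n p) * u n z"

lemma continuous_on_fnorm: "continuous_on K (fnorm n)"
  unfolding fnorm_def by (intro continuous_intros continuous_on_u)

lemma fnorm_closed_kern_cone: "closed_kern_cone (fnorm n)"
  using closed_kern_cone_scale[OF u_closed_kern_cone, of "1 / u n p"] u_pos[OF p_in, of n]
  by (simp add: fnorm_def[abs_def])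

lemma fnorm_pos: "z \<in> K \<Longrightarrow> fnorm n z > 0"
  using u_pos[of z n] u_pos[OF p_in, of n] by (simp add: fnorm_def)

lemma fnorm_le: "z \<in> K \<Longrightarrow> fnorm n z \<le> osc"
  using u_le[OF _ p_in, of z n] u_pos[OF p_in, of n] by (simp add: fnorm_def field_simps)

lemma iterate_fnorm:
  assumes "z \<in> K"
  shows "(L ^^ m) (fnorm n) z = u (m + n) z / u n p"
  using iterate_scale[OF continuous_on_u assms, of m "1 / u n p" n]
  by (simp add: fnorm_def[abs_def] u_def funpow_add)

text \<open>Arzela-Ascoli: \<open>osc\<close> bounds all normalised iterates, and
  \<open>osc * Lip\<close> is a common Lipschitz constant.\<close>

lemma fnorm_subsequence:
  obtains v r where "continuous_on K v" "strict_mono (r :: nat \<Rightarrow> nat)"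
    "uniform_limit K (\<lambda>k. fnorm (r k)) v sequentially"
proof (rule Arzela_Ascoli[OF compact, of fnorm osc])
  show "norm (fnorm n z) \<le> osc" if "z \<in> K" for n z
    using fnorm_pos[OF that] fnorm_le[OF that] by (simp add: abs_of_pos)
  show "\<exists>d>0. \<forall>n y. y \<in> K \<and> norm (x - y) < d \<longrightarrow> norm (fnorm n x - fnorm n y) < e"
    if x: "x \<in> K" and e: "e > 0" for x and e :: real
  proof (intro exI[of _ "e / (osc * Lip + 1)"] conjI allI impI)
    have nn: "osc * Lip \<ge> 0" using Lip_nonneg by (simp add: osc_def)
    then show "e / (osc * Lip + 1) > 0" using e by simp
    fix n y assume y: "y \<in> K \<and> norm (x - y) < e / (osc * Lip + 1)"
    have "\<bar>fnorm n x - fnorm n y\<bar> \<le> osc * Lip * norm (x - y)"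
      using closed_kern_cone_Lipschitz[OF fnorm_closed_kern_cone _ fnorm_le] fnorm_pos x y
      by (meson less_imp_le)
    also have "\<dots> \<le> (osc * Lip + 1) * norm (x - y)"
      by (intro mult_right_mono) auto
    also have "\<dots> < e" using y nn by (simp add: field_simps)
    finally show "norm (fnorm n x - fnorm n y) < e" by simp
  qed
next
  fix g k
  assume *: "continuous_on K g" "strict_mono (k :: nat \<Rightarrow> nat)"
    "\<And>e. 0 < e \<Longrightarrow> \<exists>N. \<forall>n x. n \<ge> N \<and> x \<in> K \<longrightarrow> norm (fnorm (k n) x - g x) < e"
  from *(3) have "uniform_limit K (\<lambda>j. fnorm (k j)) g sequentially"
    unfolding uniform_limit_sequentially_iff dist_norm by blast
  with * show thesis by (intro that)
qed

text \<open>The sign \<open>\<sigma>\<close> treats maxima and minima simultaneously.\<close>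

lemma limit_extremal_quotient:
  fixes \<sigma> :: real
  assumes \<sigma>: "\<sigma> = 1 \<or> \<sigma> = -1"
    and v: "continuous_on K v" and r: "strict_mono (r :: nat \<Rightarrow> nat)"
    and lim: "uniform_limit K (\<lambda>k. fnorm (r k)) v sequentially"
  obtains \<alpha> where "\<And>z. z \<in> K \<Longrightarrow> \<sigma> * L v z \<le> \<sigma> * \<alpha> * v z"
    "\<And>m. \<exists>z\<in>K. L v ((\<theta> ^^ m) z) = \<alpha> * v ((\<theta> ^^ m) z)"
proof -
  have \<sigma>2: "\<sigma> * \<sigma> = 1" and \<sigma>1: "\<bar>\<sigma>\<bar> = 1" using \<sigma> by auto
  \<comment> \<open>For \<open>\<sigma> = -1\<close> the maximum of \<open>h n\<close> is minus the
    minimum of the quotient.\<close>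
  define h where "h = (\<lambda>n z. \<sigma> * u (Suc n) z / u n z)"
  have "\<exists>z\<in>K. \<forall>w\<in>K. h n w \<le> h n z" for n
  proof (rule continuous_attains_sup[OF compact])
    show "K \<noteq> {}" using p_in by auto
    show "continuous_on K (h n)"
      unfolding h_def using u_pos[of _ n] by (intro continuous_intros continuous_on_u) fastforce
  qed
  then obtain x where x: "\<And>n. x n \<in> K" "\<And>n w. w \<in> K \<Longrightarrow> h n w \<le> h n (x n)" by metis
  define A where "A = (\<lambda>n. h n (x n))"
  have A: "\<sigma> * u (Suc n) z \<le> A n * u n z" if "z \<in> K" for n z
    using x(2)[OF that, of n] u_pos[OF that, of n] by (simp add: A_def h_def field_simps)
  have Ax: "\<sigma> * u (Suc n) (x n) = A n * u n (x n)" for n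
    using u_pos[OF x(1)[of n], of n] by (simp add: A_def h_def)
  \<comment> \<open>The positive operator preserves
    \<open>\<sigma> * u (Suc n) \<le> A n * u n\<close>; evaluating the result at the maximiser for
    \<open>Suc n\<close> compares the two maxima.\<close>
  have "A (Suc n) \<le> A n" for n
  proof -
    let ?y = "x (Suc n)"
    have "L (\<lambda>w. \<sigma> * u (Suc n) w) ?y \<le> L (\<lambda>w. A n * u n w) ?y"
      by (intro transfer_mono continuous_intros continuous_on_u A x(1))
    then have "\<sigma> * u (Suc (Suc n)) ?y \<le> A n * u (Suc n) ?y"
      by (simp only: transfer_scale[OF continuous_on_u x(1)] u_Suc[symmetric])
    then have "A (Suc n) * u (Suc n) ?y \<le> A n * u (Suc n) ?y" using Ax[of "Suc n"] by simp
    then show ?thesis using u_pos[OF x(1), of "Suc n" "Suc n"] by simp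
  qed
  then have dec: "decseq A" by (rule decseq_SucI)
  have "A n \<ge> - (opbound * osc)" for n
  proof -
    have "\<bar>\<sigma> * u (Suc n) (x n)\<bar> \<le> opbound * osc * u n (x n)"
      using u_Suc_le[OF x(1)] u_pos[OF x(1)] \<sigma>1 by (simp add: abs_mult abs_of_pos)
    then have "- (opbound * osc) * u n (x n) \<le> A n * u n (x n)"
      unfolding Ax mult_minus_left by linarith
    then show ?thesis using u_pos[OF x(1), of n n] by (simp only: mult_le_cancel_right_pos)
  qed
  then obtain \<alpha> where \<alpha>: "A \<longlonglongrightarrow> \<alpha>" "\<And>n. \<alpha> \<le> A n"
    using decseq_convergent[OF dec] by blast
  \<comment> \<open>\<open>F\<close> is the defect in
    \<open>\<sigma> * L v \<le> \<alpha> * v\<close>, \<open>G m\<close> is its \<open>m\<close>-th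
    iterate written out, and \<open>Gk m k\<close> is the same expression for the approximant
    \<open>fnorm (r k)\<close>.\<close>
  define F where "F = (\<lambda>w. \<alpha> * v w - \<sigma> * L v w)"
  define G where "G = (\<lambda>m z. \<alpha> * (L ^^ m) v z - \<sigma> * (L ^^ Suc m) v z)"
  define Gk where "Gk = (\<lambda>m k z. \<alpha> * (L ^^ m) (fnorm (r k)) z - \<sigma> * (L ^^ Suc m) (fnorm (r k)) z)"
  have Gk_eq: "Gk m k z = (\<alpha> * u (m + r k) z - \<sigma> * u (Suc (m + r k)) z) / u (r k) p" if "z \<in> K" for m k z
    unfolding Gk_def iterate_fnorm[OF that] by (simp add: diff_divide_distrib)
  have Glim: "uniform_limit K (Gk m) (G m) sequentially" for m
    unfolding Gk_def G_def
    by (intro uniform_limit_intros bounded_linear.uniform_limit[OF bounded_linear_mult_right]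
      iterate_tendsto_uniform continuous_on_fnorm v lim)
  have contLv: "continuous_on K (L v)" by (rule continuous_on_transfer[OF v])
  have contF: "continuous_on K F" unfolding F_def by (intro continuous_intros v contLv)
  have contG: "continuous_on K (G m)" for m
    unfolding G_def by (intro continuous_intros iterate_continuous v)
  have GF: "(L ^^ m) F z = G m z" if "z \<in> K" for m z
    unfolding F_def G_def funpow_Suc_right o_apply
    using iterate_diff[OF continuous_on_mult_left[OF v] continuous_on_mult_left[OF contLv] that]
      iterate_scale[OF v that] iterate_scale[OF contLv that] by simp
  have F_nonneg: "F z \<ge> 0" if z: "z \<in> K" for z
  proof -
    have lim1: "(\<lambda>k. fnorm (r k) z) \<longlonglongrightarrow> v z"
      by (rule tendsto_uniform_limitI[OF lim z])
    have lim2: "(\<lambda>k. L (fnorm (r k)) z) \<longlonglongrightarrow> L v z"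
      by (rule tendsto_uniform_limitI[OF transfer_tendsto_uniform[OF continuous_on_fnorm v lim] z])
    have lim3: "(\<lambda>k. A (r k)) \<longlonglongrightarrow> \<alpha>"
      using LIMSEQ_subseq_LIMSEQ[OF \<alpha>(1) r] by (simp add: o_def)
    have "\<sigma> * L (fnorm (r k)) z \<le> A (r k) * fnorm (r k) z" for k
    proof -
      have "L (fnorm (r k)) z = u (Suc (r k)) z / u (r k) p"
        using iterate_fnorm[OF z, of 1 "r k"] by simp
      then show ?thesis
        using A[OF z, of "r k"] u_pos[OF p_in, of "r k"] by (simp add: fnorm_def divide_right_mono)
    qed
    then have "\<sigma> * L v z \<le> \<alpha> * v z"
      by (intro LIMSEQ_le[OF tendsto_mult[OF tendsto_const lim2] tendsto_mult[OF lim3 lim1]]) auto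
    then show ?thesis by (simp add: F_def)
  qed
  \<comment> \<open>If \<open>G m\<close> were positive throughout, its minimum over the compact
    \<open>K\<close> would be positive, and so would \<open>Gk m k\<close> be for some
    \<open>k\<close>. But at the maximiser \<open>x n\<close> for the actual index
    \<open>n = m + r k\<close>, \<open>Gk m k\<close> has the sign of
    \<open>\<alpha> - A n \<le> 0\<close>.\<close>
  have zero: "\<exists>z\<in>K. G m z = 0" for m
  proof (rule ccontr)
    assume no: "\<not> ?thesis"
    have G_nonneg: "G m z \<ge> 0" if "z \<in> K" for z
      using iterate_nonneg[of F, OF F_nonneg that, of m] GF[OF that, of m] by simp
    obtain y where y: "y \<in> K" "\<And>z. z \<in> K \<Longrightarrow> G m y \<le> G m z"
      using continuous_attains_inf[OF compact _ contG] p_in by blast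
    have "G m y > 0" using G_nonneg[OF y(1)] no y(1) by force
    then have "\<forall>\<^sub>F k in sequentially. \<forall>z\<in>K. dist (Gk m k z) (G m z) < G m y"
      by (intro uniform_limitD[OF Glim])
    then obtain k where k: "\<And>z. z \<in> K \<Longrightarrow> dist (Gk m k z) (G m z) < G m y"
      by (auto simp: eventually_sequentially)
    define n where "n = m + r k"
    have "Gk m k (x n) > 0"
      using k[OF x(1)[of n]] y(2)[OF x(1)[of n]] by (simp add: dist_real_def)
    then have "\<alpha> * u n (x n) > \<sigma> * u (Suc n) (x n)"
      unfolding Gk_eq[OF x(1)] n_def[symmetric] using u_pos[OF p_in, of "r k"]
      by (simp add: zero_less_divide_iff)
    then have "\<alpha> * u n (x n) > A n * u n (x n)" using Ax by simp
    then have "\<alpha> > A n" using u_pos[OF x(1), of n n] by simp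
    with \<alpha>(2)[of n] show False by simp
  qed
  show thesis
  proof (rule that[of "\<sigma> * \<alpha>"])
    show "\<sigma> * L v z \<le> \<sigma> * (\<sigma> * \<alpha>) * v z" if "z \<in> K" for z
      using F_nonneg[OF that] \<sigma>2 by (simp add: F_def flip: mult.assoc)
    fix m
    obtain z where z: "z \<in> K" "G m z = 0" using zero by blast
    \<comment> \<open>A zero of the \<open>m\<close>-th iterate of the nonnegative \<open>F\<close>
      descends along the contracting branch.\<close>
    have "F ((\<theta> ^^ m) z) = 0"
      by (rule iterate_zero_imp[of F, OF contF F_nonneg z(1)]) (use GF z in auto)
    then have "\<sigma> * (\<sigma> * L v ((\<theta> ^^ m) z)) = \<sigma> * (\<alpha> * v ((\<theta> ^^ m) z))" by (simp add: F_def)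
    then have "L v ((\<theta> ^^ m) z) = \<sigma> * \<alpha> * v ((\<theta> ^^ m) z)"
      using \<sigma>2 by (simp flip: mult.assoc)
    then show "\<exists>z\<in>K. L v ((\<theta> ^^ m) z) = \<sigma> * \<alpha> * v ((\<theta> ^^ m) z)" using z(1) by blast
  qed
qed

lemma eigenfunction_exists:
  obtains v \<rho> where "continuous_on K v" "closed_kern_cone v" "\<And>z. z \<in> K \<Longrightarrow> v z > 0"
    "\<And>z. z \<in> K \<Longrightarrow> L v z = \<rho> * v z"
proof -
  obtain v r where v: "continuous_on K v" and r: "strict_mono (r :: nat \<Rightarrow> nat)"
    and lim: "uniform_limit K (\<lambda>k. fnorm (r k)) v sequentially"
    by (rule fnorm_subsequence)
  have cone: "closed_kern_cone v"
  proof (rule closed_kern_cone_closed)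
    fix e :: real assume "e > 0"
    then have "\<forall>\<^sub>F k in sequentially. \<forall>z\<in>K. dist (fnorm (r k) z) (v z) < e"
      by (rule uniform_limitD[OF lim])
    then obtain k where "\<forall>z\<in>K. dist (fnorm (r k) z) (v z) < e" by (auto simp: eventually_sequentially)
    then show "\<exists>h. closed_kern_cone h \<and> (\<forall>z\<in>K. \<bar>v z - h z\<bar> \<le> e)"
      by (intro exI[of _ "fnorm (r k)"]) (auto simp: fnorm_closed_kern_cone dist_real_def abs_minus_commute less_imp_le)
  qed
  have "(\<lambda>k. fnorm (r k) p) \<longlonglongrightarrow> v p" by (rule tendsto_uniform_limitI[OF lim p_in])
  moreover have "fnorm n p = 1" for n using u_pos[OF p_in, of n] by (simp add: fnorm_def)
  ultimately have vp: "v p = 1" by (simp add: LIMSEQ_const_iff)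
  \<comment> \<open>The normalisation \<open>v p = 1\<close> survives the limit, and the logarithmic
    Lipschitz bound spreads positivity from \<open>p\<close> over \<open>K\<close>.\<close>
  have pos: "v z > 0" if "z \<in> K" for z
  proof -
    have "0 < exp (2 * s / \<gamma> * norm (p - z)) * v z"
      using closed_kern_cone_log_Lipschitz[OF cone p_in that] vp by linarith
    then show ?thesis by (simp add: zero_less_mult_iff)
  qed
  obtain \<alpha> where \<alpha>: "\<And>z. z \<in> K \<Longrightarrow> L v z \<le> \<alpha> * v z"
    "\<And>m. \<exists>z\<in>K. L v ((\<theta> ^^ m) z) = \<alpha> * v ((\<theta> ^^ m) z)"
    using limit_extremal_quotient[OF _ v r lim, of 1] by auto
  obtain \<beta> where \<beta>: "\<And>z. z \<in> K \<Longrightarrow> L v z \<ge> \<beta> * v z"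
    "\<And>m. \<exists>z\<in>K. L v ((\<theta> ^^ m) z) = \<beta> * v ((\<theta> ^^ m) z)"
    using limit_extremal_quotient[OF _ v r lim, of "-1"] by auto
  \<comment> \<open>The upper and the lower bound of \<open>L v / v\<close> are both attained on
    every deep image, where a continuous function has almost no oscillation.\<close>
  have "\<alpha> = \<beta>"
  proof (rule values_on_deep_images_eq)
    show "continuous_on K (\<lambda>z. L v z / v z)"
      using pos by (intro continuous_intros continuous_on_transfer v) fastforce
    have nz: "v ((\<theta> ^^ m) z) \<noteq> 0" if "z \<in> K" for m z
      using pos[OF theta_iterate_in[OF that, of m]] by simp
    show "\<exists>z\<in>K. L v ((\<theta> ^^ m) z) / v ((\<theta> ^^ m) z) = \<alpha>" for m using \<alpha>(2)[of m] nz by force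
    show "\<exists>z\<in>K. L v ((\<theta> ^^ m) z) / v ((\<theta> ^^ m) z) = \<beta>" for m using \<beta>(2)[of m] nz by force
  qed
  then have "L v z = \<alpha> * v z" if "z \<in> K" for z using \<alpha>(1)[OF that] \<beta>(1)[OF that] by simp
  with v cone pos show thesis by (rule that)
qed

section \<open>Comparison and uniqueness of positive eigenfunctions\<close>

lemma iterate_eigen:
  assumes "continuous_on K v" "\<And>z. z \<in> K \<Longrightarrow> L v z = \<rho> * (v z :: real)"
  shows "z \<in> K \<Longrightarrow> (L ^^ m) v z = \<rho> ^ m * v z"
proof (induction m arbitrary: z)
  case (Suc m)
  then have "L ((L ^^ m) v) z = L (\<lambda>w. \<rho> ^ m * v w) z" by (intro transfer_cong) auto
  with Suc.prems show ?case using transfer_scale[OF assms(1)] assms(2) by simp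
qed simp

lemma quotient_max:
  assumes v: "continuous_on K v" "\<And>z. z \<in> K \<Longrightarrow> v z > 0"
    and w: "continuous_on K w"
  obtains x \<alpha> where "x \<in> K" "w x = \<alpha> * v x" "\<And>z. z \<in> K \<Longrightarrow> w z \<le> \<alpha> * (v z :: real)"
proof -
  have "continuous_on K (\<lambda>z. w z / v z)"
    using v(2) by (intro continuous_intros v w) fastforce
  then obtain x where x: "x \<in> K" "\<And>z. z \<in> K \<Longrightarrow> w z / v z \<le> w x / v x"
    using continuous_attains_sup[OF compact, of "\<lambda>z. w z / v z"] p_in by blast
  show thesis
  proof (rule that[OF x(1), of "w x / v x"])
    show "w x = w x / v x * v x" using v(2)[OF x(1)] by simp
    show "w z \<le> w x / v x * v z" if "z \<in> K" for z
      using x(2)[OF that] v(2)[OF that] by (simp add: pos_divide_le_eq)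
  qed
qed

text \<open>The least multiple \<open>\<alpha> * v\<close> above \<open>w\<close> touches it at some
  \<open>x\<close>; applying the monotone operator there gives
  \<open>\<mu> * w x \<le> \<rho> * w x\<close>.\<close>

lemma eigenvalue_le:
  fixes v w :: "complex \<Rightarrow> real"
  assumes v: "continuous_on K v" "\<And>z. z \<in> K \<Longrightarrow> v z > 0" "\<And>z. z \<in> K \<Longrightarrow> L v z = \<rho> * v z"
    and w: "continuous_on K w" "\<And>z. z \<in> K \<Longrightarrow> w z > 0" "\<And>z. z \<in> K \<Longrightarrow> L w z = \<mu> * w z"
  shows "\<mu> \<le> \<rho>"
proof -
  obtain x \<alpha> where x: "x \<in> K" "w x = \<alpha> * v x" "\<And>z. z \<in> K \<Longrightarrow> w z \<le> \<alpha> * v z"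
    using quotient_max[OF v(1,2) w(1)] by blast
  have "L w x \<le> L (\<lambda>z. \<alpha> * v z) x"
    by (intro transfer_mono w continuous_intros v x)
  then have "\<mu> * w x \<le> \<rho> * w x"
    using transfer_scale[OF v(1) x(1)] w(3)[OF x(1)] v(3)[OF x(1)] x(2) by (simp add: mult.left_commute)
  then show ?thesis using w(2)[OF x(1)] by simp
qed

lemma eigenfunction_vanishes_deep:
  assumes "continuous_on K g" "\<And>z. z \<in> K \<Longrightarrow> g z \<ge> 0" "\<And>z. z \<in> K \<Longrightarrow> L g z = \<rho> * g z"
    and "x \<in> K" "g x = (0 :: real)"
  shows "g ((\<theta> ^^ m) x) = 0"
  by (rule iterate_zero_imp[OF assms(1,2,4)]) (use iterate_eigen[OF assms(1,3,4)] assms(5) in auto)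

text \<open>Comparison in both directions equates the eigenvalues. Then the gap between
  \<open>w\<close> and a touching multiple of \<open>v\<close> is a nonnegative eigenfunction with a
  zero, so it vanishes along a whole orbit of \<open>\<theta>\<close>.\<close>

lemma eigenfunction_unique:
  fixes v w :: "complex \<Rightarrow> real"
  assumes v: "continuous_on K v" "\<And>z. z \<in> K \<Longrightarrow> v z > 0" "\<And>z. z \<in> K \<Longrightarrow> L v z = \<rho> * v z"
    and w: "continuous_on K w" "\<And>z. z \<in> K \<Longrightarrow> w z > 0" "\<And>z. z \<in> K \<Longrightarrow> L w z = \<mu> * w z"
  obtains c :: real where "\<And>z. z \<in> K \<Longrightarrow> w z = c * v z"
proof -
  have "\<mu> = \<rho>" using eigenvalue_le[OF v w] eigenvalue_le[OF w v] by simp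
  with w(3) have w3: "L w z = \<rho> * w z" if "z \<in> K" for z using that by simp
  \<comment> \<open>Used with \<open>\<sigma> = 1\<close> for the maximum of \<open>w / v\<close>
    and with \<open>\<sigma> = -1\<close> for its minimum, which is then
    \<open>- \<beta>\<close>.\<close>
  have half: "\<exists>\<alpha>. (\<forall>z\<in>K. \<sigma> * w z \<le> \<alpha> * v z) \<and> (\<forall>m. \<exists>z\<in>K. \<sigma> * w ((\<theta> ^^ m) z) / v ((\<theta> ^^ m) z) = \<alpha>)" for \<sigma>
  proof -
    have \<sigma>w: "continuous_on K (\<lambda>z. \<sigma> * w z)" by (intro continuous_intros w)
    obtain x \<alpha> where x: "x \<in> K" "\<sigma> * w x = \<alpha> * v x" "\<And>z. z \<in> K \<Longrightarrow> \<sigma> * w z \<le> \<alpha> * v z"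
      using quotient_max[OF v(1,2) \<sigma>w] by blast
    define g where "g = (\<lambda>z. \<alpha> * v z - \<sigma> * w z)"
    have "g ((\<theta> ^^ m) x) = 0" for m
    proof (rule eigenfunction_vanishes_deep)
      show "continuous_on K g" unfolding g_def by (intro continuous_intros v w)
      show "L g z = \<rho> * g z" if "z \<in> K" for z
        unfolding g_def using transfer_diff[OF continuous_on_mult_left[OF v(1)] \<sigma>w that]
          transfer_scale[OF v(1) that] transfer_scale[OF w(1) that] v(3)[OF that] w3[OF that]
        by (simp add: algebra_simps)
    qed (use x in \<open>auto simp: g_def\<close>)
    then have "\<sigma> * w ((\<theta> ^^ m) x) / v ((\<theta> ^^ m) x) = \<alpha>" for m
      using v(2)[OF theta_iterate_in[OF x(1), of m]] by (simp add: g_def field_simps)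
    with x show ?thesis by blast
  qed
  obtain \<alpha> where \<alpha>: "\<And>z. z \<in> K \<Longrightarrow> w z \<le> \<alpha> * v z" "\<And>m. \<exists>z\<in>K. w ((\<theta> ^^ m) z) / v ((\<theta> ^^ m) z) = \<alpha>"
    using half[of 1] by auto
  obtain \<beta> where \<beta>: "\<And>z. z \<in> K \<Longrightarrow> - w z \<le> \<beta> * v z" "\<And>m. \<exists>z\<in>K. - w ((\<theta> ^^ m) z) / v ((\<theta> ^^ m) z) = \<beta>"
    using half[of "-1"] by auto
  have "\<alpha> = - \<beta>"
  proof (rule values_on_deep_images_eq)
    show "continuous_on K (\<lambda>z. w z / v z)"
      using v(2) by (intro continuous_intros v w) fastforce
    show "\<exists>z\<in>K. w ((\<theta> ^^ m) z) / v ((\<theta> ^^ m) z) = - \<beta>" for m using \<beta>(2)[of m] by force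
  qed (rule \<alpha>(2))
  then have "w z = \<alpha> * v z" if "z \<in> K" for z using \<alpha>(1)[OF that] \<beta>(1)[OF that] by simp
  then show thesis by (rule that)
qed

end

section \<open>Transfer to the closure of \<open>H\<close>, with conjugation symmetry\<close>

theorem theorem5p10:
  fixes \<gamma> s :: real and B H :: "complex set"
  assumes "\<gamma> \<ge> 1"
    and "countable B" and "infinite B"
    and "B \<subseteq> {z. Re z \<ge> \<gamma>}"
    and "s > 0"
    and "(\<lambda>b. norm b powr (- 2 * s)) summable_on B"
    and "bounded H" and "open H" and "mildly_regular H"
    and "G_disk \<gamma> \<subseteq> H"
    and "\<forall>z\<in>H. Re z > 0"
  shows
    \<comment> \<open>L_s is a well-defined bounded linear map on C(closure H)\<close>
    "(\<forall>f. continuous_on (closure H) f \<longrightarrow>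
        (\<forall>z\<in>closure H. (\<lambda>b. f (1 / (z + b)) / complex_of_real (norm (z + b) powr (2 * s))) summable_on B)
        \<and> continuous_on (closure H) (Lop s B f))
     \<and> (\<forall>f g a c. continuous_on (closure H) f \<longrightarrow> continuous_on (closure H) g \<longrightarrow>
        (\<forall>z\<in>closure H. Lop s B (\<lambda>w. a * f w + c * g w) z = a * Lop s B f z + c * Lop s B g z))
     \<and> (\<exists>K. \<forall>f m. continuous_on (closure H) f \<longrightarrow> (\<forall>z\<in>closure H. norm (f z) \<le> m) \<longrightarrow>
        (\<forall>z\<in>closure H. norm (Lop s B f z) \<le> K * m))
     \<and>
    \<comment> \<open>strictly positive Lipschitz eigenfunction v, unique up to scalars, with (i)-(iii) and symmetry\<close>
     (\<exists>v :: complex \<Rightarrow> real. \<exists>ev::complex.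
        (\<forall>z\<in>closure H. v z > 0)
      \<and> (\<exists>C. C-lipschitz_on (closure H) v)
      \<and> (\<forall>z\<in>closure H. Lop s B (\<lambda>w. complex_of_real (v w)) z = ev * complex_of_real (v z))
      \<and> (\<forall>w :: complex \<Rightarrow> real. \<forall>\<mu>::complex.
           continuous_on (closure H) w \<longrightarrow> (\<forall>z\<in>closure H. w z > 0) \<longrightarrow>
           (\<forall>z\<in>closure H. Lop s B (\<lambda>u. complex_of_real (w u)) z = \<mu> * complex_of_real (w z)) \<longrightarrow>
           (\<exists>c. \<forall>z\<in>closure H. w z = c * v z))
      \<and> (\<forall>z0\<in>closure H. \<forall>z1\<in>closure H. v z0 \<le> v z1 * exp ((sqrt 5 * s / \<gamma>) * norm (z1 - z0)))
      \<and> (\<forall>x1 x2 y. 0 \<le> x1 \<longrightarrow> x1 \<le> x2 \<longrightarrow> Complex x1 y \<in> closure H \<longrightarrow> Complex x2 y \<in> closure H \<longrightarrow>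
           v (Complex x1 y) \<ge> v (Complex x2 y) \<and>
           v (Complex x2 y) \<ge> v (Complex x1 y) * exp ((- 2 * s / \<gamma>) * (x2 - x1)))
      \<and> (\<forall>x y1 y2. Complex x y1 \<in> closure H \<longrightarrow> Complex x y2 \<in> closure H \<longrightarrow>
           v (Complex x y1) \<le> v (Complex x y2) * exp ((s / \<gamma>) * \<bar>y1 - y2\<bar>))
      \<and> ((cnj ` B = B \<and> cnj ` H = H) \<longrightarrow> (\<forall>z\<in>closure H. v (cnj z) = v z)))"
proof -
  define K where "K = closure H"
  have compact: "compact K" unfolding K_def using assms(7) by (simp add: compact_closure)
  have ReK: "Re z \<ge> 0" if "z \<in> K" for z
  proof -
    have "K \<subseteq> {z. Re z \<ge> 0}"
      unfolding K_def using assms(11) by (intro closure_minimal closed_halfspace_Re_ge) force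
    with that show ?thesis by auto
  qed
  obtain R where R: "\<And>z. z \<in> K \<Longrightarrow> norm z \<le> R"
    using compact_imp_bounded[OF compact] by (auto simp: bounded_iff)
  have disk: "cball (complex_of_real (1 / (2 * \<gamma>))) (1 / (2 * \<gamma>)) \<subseteq> K"
    using closure_mono[OF assms(10)] assms(1) by (simp add: K_def G_disk_def)
  have "0 \<notin> B" using assms(1,4) by auto
  then obtain b0 where b0: "b0 \<in> B" "norm b0 \<ge> R + 2"
    using infinite_summable_unbounded[of B "2 * s" "R + 2"] assms by auto
  interpret transfer_setting \<gamma> s R B K b0
    by unfold_locales (use assms ReK R disk compact b0 in auto)

  obtain v \<rho> where v: "continuous_on K v" "closed_kern_cone v" "\<And>z. z \<in> K \<Longrightarrow> v z > 0"
    and eigen: "\<And>z. z \<in> K \<Longrightarrow> transfer s B v z = \<rho> * v z"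
    by (rule eigenfunction_exists) blast
  have Lop_of_real: "Lop s B (\<lambda>w. complex_of_real (f w)) z = complex_of_real (transfer s B f z)"
    if "continuous_on K f" "z \<in> K" for f z
    unfolding Lop_eq_transfer by (rule transfer_of_real[OF that])
  have unique: "\<exists>c. \<forall>z\<in>K. w z = c * v z"
    if w: "continuous_on K w" "\<forall>z\<in>K. w z > 0"
      "\<forall>z\<in>K. Lop s B (\<lambda>u. complex_of_real (w u)) z = \<mu> * complex_of_real (w z)" for w \<mu>
  proof -
    \<comment> \<open>The competing eigenvalue \<open>\<mu>\<close> may be complex; since
      \<open>w\<close> and its image are real, taking real parts reduces to the real uniqueness
      result.\<close>
    have "transfer s B w z = Re \<mu> * w z" if "z \<in> K" for z
    proof -
      have "complex_of_real (transfer s B w z) = \<mu> * complex_of_real (w z)"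
        using w(3) Lop_of_real[OF w(1) that] that by simp
      from arg_cong[OF this, of Re] show ?thesis by simp
    qed
    from eigenfunction_unique[OF v(1,3) eigen w(1) w(2)[rule_format] this]
    obtain c where "\<And>z. z \<in> K \<Longrightarrow> w z = c * v z" by blast
    then show ?thesis by blast
  qed
  obtain V where V: "\<And>z. z \<in> K \<Longrightarrow> norm (v z) \<le> V" using bounded_on_K[OF v(1)] by blast
  have "V \<ge> 0" using V[OF p_in] norm_ge_zero[of "v p"] by linarith
  have lipschitz: "(V * Lip)-lipschitz_on K v"
  proof (rule lipschitz_onI)
    show "dist (v z) (v w) \<le> V * Lip * dist z w" if "z \<in> K" "w \<in> K" for z w
      unfolding dist_norm real_norm_def
    proof (rule closed_kern_cone_Lipschitz[OF v(2) _ _ that])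
      show "0 \<le> v z" "v z \<le> V" if "z \<in> K" for z
        using V[OF that] v(3)[OF that] by simp_all
    qed
  qed (simp add: \<open>V \<ge> 0\<close> Lip_nonneg)
  have i: "v z0 \<le> v z1 * exp ((sqrt 5 * s / \<gamma>) * norm (z1 - z0))" if "z0 \<in> K" "z1 \<in> K" for z0 z1
  proof -
    \<comment> \<open>The cone estimate has the smaller constant \<open>2 * s / \<gamma>\<close>, so
      (i) follows by weakening.\<close>
    have "2 \<le> sqrt 5" by (rule real_le_rsqrt) simp
    then have "2 * s / \<gamma> * norm (z0 - z1) \<le> (sqrt 5 * s / \<gamma>) * norm (z1 - z0)"
      using assms(1,5) by (simp add: norm_minus_commute divide_right_mono mult_right_mono)
    then have "exp (2 * s / \<gamma> * norm (z0 - z1)) * v z1 \<le> exp ((sqrt 5 * s / \<gamma>) * norm (z1 - z0)) * v z1"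
      using v(3)[OF that(2)] by (intro mult_right_mono) auto
    with closed_kern_cone_log_Lipschitz[OF v(2) that] show ?thesis by (simp add: mult.commute)
  qed
  have ii: "v (Complex x1 y) \<ge> v (Complex x2 y) \<and>
      v (Complex x2 y) \<ge> v (Complex x1 y) * exp ((- 2 * s / \<gamma>) * (x2 - x1))"
    if x: "0 \<le> x1" "x1 \<le> x2" and K: "Complex x1 y \<in> K" "Complex x2 y \<in> K" for x1 x2 y
  proof
    show "v (Complex x2 y) \<le> v (Complex x1 y)"
      using closed_kern_cone_le[OF v(2) K(2,1), of 1] kern_antimono_Re[of \<gamma>, OF _ assms(5) _ x] assms(1) by simp
    have "norm (Complex x1 y - Complex x2 y) = x2 - x1" using x by (simp add: cmod_def)
    with closed_kern_cone_log_Lipschitz[OF v(2) K]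
    have "v (Complex x1 y) \<le> exp (2 * s / \<gamma> * (x2 - x1)) * v (Complex x2 y)" by simp
    then have "v (Complex x1 y) * exp (- (2 * s / \<gamma> * (x2 - x1))) \<le> v (Complex x2 y)"
      by (simp add: exp_minus field_simps)
    then show "v (Complex x1 y) * exp ((- 2 * s / \<gamma>) * (x2 - x1)) \<le> v (Complex x2 y)" by simp
  qed
  have iii: "v (Complex x y1) \<le> v (Complex x y2) * exp ((s / \<gamma>) * \<bar>y1 - y2\<bar>)"
    if K: "Complex x y1 \<in> K" "Complex x y2 \<in> K" for x y1 y2
  proof -
    have "0 \<le> x" using ReK[OF K(1)] by simp
    then show ?thesis
      using closed_kern_cone_le[OF v(2) K, of "exp ((s / \<gamma>) * \<bar>y1 - y2\<bar>)"]
        kern_log_Lipschitz_Im[of \<gamma>, OF _ assms(5)] assms(1) by (simp add: mult.commute)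
  qed
  have sym: "v (cnj z) = v z" if cB: "cnj ` B = B" and cH: "cnj ` H = H" and z: "z \<in> K" for z
  proof -
    define w where "w = (\<lambda>z. v (cnj z))"
    have cK: "cnj z \<in> K" if "z \<in> K" for z
    proof -
      have "cnj ` closure H \<subseteq> closure (cnj ` H)"
        by (intro image_closure_subset continuous_intros) (auto simp: closure_subset)
      with that cH show ?thesis by (auto simp: K_def)
    qed
    have w: "continuous_on K w"
      unfolding w_def by (rule continuous_on_compose2[OF v(1)]) (auto intro!: continuous_intros cK)
    have w_pos: "w z > 0" if "z \<in> K" for z using v(3) cK that by (simp add: w_def)
    have mod: "cmod (cnj z + cnj b) = cmod (z + b)" for z b
      by (simp flip: complex_cnj_add)
    \<comment> \<open>Conjugating the argument amounts to conjugating the parameters, and reindexing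
      the sum by \<open>cnj\<close> leaves \<open>B\<close> unchanged; so \<open>w\<close> is again
      a positive eigenfunction.\<close>
    have "transfer s B w z = \<rho> * w z" if "z \<in> K" for z
    proof -
      have "transfer s B w z = (\<Sum>\<^sub>\<infinity>b\<in>B. (\<lambda>b. kern s b (cnj z) *\<^sub>R v (1 / (cnj z + b))) (cnj b))"
        unfolding transfer_def w_def kern_def
        by (simp add: mod)
      also have "\<dots> = (\<Sum>\<^sub>\<infinity>b\<in>cnj ` B. kern s b (cnj z) *\<^sub>R v (1 / (cnj z + b)))"
        by (subst infsum_reindex) (auto simp: inj_on_def o_def)
      also have "\<dots> = \<rho> * w z"
        unfolding cB using eigen[OF cK[OF that]] by (simp add: transfer_def w_def)
      finally show ?thesis .
    qed
    from eigenfunction_unique[OF v(1,3) eigen w w_pos this]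
    obtain c where c: "\<And>z. z \<in> K \<Longrightarrow> w z = c * v z" by blast
    \<comment> \<open>The base point is real, so the scalar given by uniqueness must be 1.\<close>
    have "w p = v p" by (simp add: w_def p_def)
    with c[OF p_in] v(3)[OF p_in] have "c = 1" by simp
    with c[OF z] show ?thesis by (simp add: w_def)
  qed
  show ?thesis
    unfolding K_def[symmetric]
  proof (intro conjI)
    show "\<forall>f. continuous_on K f \<longrightarrow>
        (\<forall>z\<in>K. (\<lambda>b. f (1 / (z + b)) / complex_of_real (norm (z + b) powr (2 * s))) summable_on B)
        \<and> continuous_on K (Lop s B f)"
      unfolding scaleR_kern_eq_divide[symmetric] Lop_eq_transfer
      by (simp add: terms_summable continuous_on_transfer)
    show "\<forall>f g a c. continuous_on K f \<longrightarrow> continuous_on K g \<longrightarrow>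
        (\<forall>z\<in>K. Lop s B (\<lambda>w. a * f w + c * g w) z = a * Lop s B f z + c * Lop s B g z)"
      unfolding Lop_eq_transfer
      by (simp add: transfer_add transfer_scale continuous_on_mult_left)
    show "\<exists>N. \<forall>f m. continuous_on K f \<longrightarrow> (\<forall>z\<in>K. norm (f z) \<le> m) \<longrightarrow>
        (\<forall>z\<in>K. norm (Lop s B f z) \<le> N * m)"
      unfolding Lop_eq_transfer by (intro exI[of _ opbound]) (simp add: norm_transfer_le)
  next
    have eigen_Lop: "Lop s B (\<lambda>w. complex_of_real (v w)) z = complex_of_real \<rho> * complex_of_real (v z)"
      if "z \<in> K" for z
      using Lop_of_real[OF v(1) that] eigen[OF that] by simp
    show "\<exists>v :: complex \<Rightarrow> real. \<exists>ev::complex.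
        (\<forall>z\<in>K. v z > 0)
      \<and> (\<exists>C. C-lipschitz_on K v)
      \<and> (\<forall>z\<in>K. Lop s B (\<lambda>w. complex_of_real (v w)) z = ev * complex_of_real (v z))
      \<and> (\<forall>w :: complex \<Rightarrow> real. \<forall>\<mu>::complex.
           continuous_on K w \<longrightarrow> (\<forall>z\<in>K. w z > 0) \<longrightarrow>
           (\<forall>z\<in>K. Lop s B (\<lambda>u. complex_of_real (w u)) z = \<mu> * complex_of_real (w z)) \<longrightarrow>
           (\<exists>c. \<forall>z\<in>K. w z = c * v z))
      \<and> (\<forall>z0\<in>K. \<forall>z1\<in>K. v z0 \<le> v z1 * exp ((sqrt 5 * s / \<gamma>) * norm (z1 - z0)))
      \<and> (\<forall>x1 x2 y. 0 \<le> x1 \<longrightarrow> x1 \<le> x2 \<longrightarrow> Complex x1 y \<in> K \<longrightarrow> Complex x2 y \<in> K \<longrightarrow>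
           v (Complex x1 y) \<ge> v (Complex x2 y) \<and>
           v (Complex x2 y) \<ge> v (Complex x1 y) * exp ((- 2 * s / \<gamma>) * (x2 - x1)))
      \<and> (\<forall>x y1 y2. Complex x y1 \<in> K \<longrightarrow> Complex x y2 \<in> K \<longrightarrow>
           v (Complex x y1) \<le> v (Complex x y2) * exp ((s / \<gamma>) * \<bar>y1 - y2\<bar>))
      \<and> ((cnj ` B = B \<and> cnj ` H = H) \<longrightarrow> (\<forall>z\<in>K. v (cnj z) = v z))"
      apply (intro exI[of _ v] exI[of _ "complex_of_real \<rho>"] conjI)
      subgoal by (intro ballI v(3))
      subgoal using lipschitz by (rule exI)
      subgoal by (intro ballI eigen_Lop)
      subgoal by (intro allI impI, rule unique)
      subgoal by (intro ballI i)
      subgoal by (intro allI impI, rule ii)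
      subgoal by (intro allI impI, rule iii)
      subgoal using sym by simp
      done
  qed
qed

end
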